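(* Let $\mathcal E$ be an ellipse in $\mathbf E^2$ and let $(a_m)_{m\in\mathbf Z}$, $(b_m)_{m\in\mathbf Z}$ be two sequences of the segments of billiard trajectories within $\mathcal E$, sharing the same caustic. Then all the points $a_m\cap b_m$ $(m\in\mathbf Z)$ belong to one conic $\mathcal K$, confocal with $\mathcal E$. Moreover, under the additional assumption that the caustic is an ellipse, we have: if both trajectories are winding in the same direction about the caustic, then $\mathcal K$ is also an ellipse; if the trajectories are winding in opposite directions, then $\mathcal K$ is a hyperbola. For a hyperbola as a caustic, it holds: if the segments $a_m$, $b_m$ intersect the long axis of $\mathcal E$ in the same direction, then $\mathcal K$ is a hyperbola, otherwise it is an ellipse.
   Context: A billiard trajectory within $\mathcal E$ is a polygonal line with vertices on $\mathcal E$ such that each pair of consecutive segments makes congruent angles with the normal to $\mathcal E$ at the common endpoint and lies on the same side of the tangent to $\mathcal E$ there. All segments of a trajectory (or their extensions) are tangent to one and the same conic confocal with $\mathcal E$, called the caustic of the trajectory. The sequence $(a_m)_{m\in\mathbf Z}$ lists the consecutive segments of a trajectory in the order of motion, which orients the segments; likewise $(b_m)$. The intersection $a_m\cap b_m$ is the intersection point of the lines containing the segments $a_m$ and $b_m$.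
   Formalization: The conic K may degenerate to an axis of E: "hyperbola" may be the short axis (for an elliptic caustic also the long axis), and "ellipse" for a hyperbolic caustic may be the long axis. This occurs, e.g., when the b_m are mirror images of the a_m in an axis, so the strict claim fails. *)

theory Defs
  imports "HOL-Analysis.Analysis"
begin

text \<open>Conics are point sets in the plane, given by their foci; two of them are confocal
  when they are described with the same pair \<open>F1\<close>, \<open>F2\<close>. The case \<open>F1 = F2\<close> is
  allowed and gives the concentric circles.\<close>

definition ellipse_with_foci :: "real^2 \<Rightarrow> real^2 \<Rightarrow> (real^2) set \<Rightarrow> bool" where
  "ellipse_with_foci F1 F2 C \<longleftrightarrow>
     (\<exists>s. dist F1 F2 < s \<and> C = {X. dist X F1 + dist X F2 = s})"

definition hyperbola_with_foci :: "real^2 \<Rightarrow> real^2 \<Rightarrow> (real^2) set \<Rightarrow> bool" where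
  "hyperbola_with_foci F1 F2 C \<longleftrightarrow>
     (\<exists>d. 0 < d \<and> d < dist F1 F2 \<and> C = {X. \<bar>dist X F1 - dist X F2\<bar> = d})"

definition det2 :: "real^2 \<Rightarrow> real^2 \<Rightarrow> real" where
  "det2 u v = u $ 1 * v $ 2 - u $ 2 * v $ 1"

text \<open>The axes of symmetry are the degenerate (double line) members of the family
  \<open>x\<^sup>2/(a\<^sup>2 - k) + y\<^sup>2/(b\<^sup>2 - k) = 1\<close>, reached for \<open>k \<rightarrow> b\<^sup>2\<close> (long axis) and
  \<open>k \<rightarrow> a\<^sup>2\<close> (short axis). For \<open>F1 = F2\<close> every line through the centre is an axis, and
  both predicates hold for exactly these lines.\<close>

definition long_axis :: "real^2 \<Rightarrow> real^2 \<Rightarrow> (real^2) set \<Rightarrow> bool" where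
  "long_axis F1 F2 L \<longleftrightarrow>
     (\<exists>u. u \<noteq> 0 \<and> det2 u (F2 - F1) = 0 \<and> L = range (\<lambda>t. midpoint F1 F2 + t *\<^sub>R u))"

definition short_axis :: "real^2 \<Rightarrow> real^2 \<Rightarrow> (real^2) set \<Rightarrow> bool" where
  "short_axis F1 F2 L \<longleftrightarrow>
     (\<exists>u. u \<noteq> 0 \<and> u \<bullet> (F2 - F1) = 0 \<and> L = range (\<lambda>t. midpoint F1 F2 + t *\<^sub>R u))"

definition confocal_conic :: "real^2 \<Rightarrow> real^2 \<Rightarrow> (real^2) set \<Rightarrow> bool" where
  "confocal_conic F1 F2 K \<longleftrightarrow> ellipse_with_foci F1 F2 K \<or> hyperbola_with_foci F1 F2 K \<or>
     long_axis F1 F2 K \<or> short_axis F1 F2 K"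

definition tangent_vector :: "(real^2) set \<Rightarrow> real^2 \<Rightarrow> real^2 \<Rightarrow> bool" where
  "tangent_vector C X v \<longleftrightarrow>
     (\<exists>\<gamma> :: real \<Rightarrow> real^2. \<gamma> 0 = X \<and> (\<forall>t. \<gamma> t \<in> C) \<and> (\<gamma> has_vector_derivative v) (at 0))"

definition normal_vector :: "(real^2) set \<Rightarrow> real^2 \<Rightarrow> real^2 \<Rightarrow> bool" where
  "normal_vector C X n \<longleftrightarrow> (\<forall>v. tangent_vector C X v \<longrightarrow> n \<bullet> v = 0)"

text \<open>A line touches a hyperbola at a point at infinity precisely when it is an asymptote.
  This cannot be left out: if the caustic is a hyperbola and a side of the trajectory passes
  through the centre, then that side lies on an asymptote of the caustic.\<close>

definition asymptote :: "(real^2) set \<Rightarrow> (real^2) set \<Rightarrow> bool" where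
  "asymptote C L \<longleftrightarrow>
     (\<exists>\<gamma> :: nat \<Rightarrow> real^2. (\<forall>n. \<gamma> n \<in> C) \<and> filterlim \<gamma> at_infinity sequentially \<and>
        (\<lambda>n. infdist (\<gamma> n) L) \<longlonglongrightarrow> 0)"

definition tangent_line :: "(real^2) set \<Rightarrow> (real^2) set \<Rightarrow> bool" where
  "tangent_line C L \<longleftrightarrow>
     (\<exists>X v. X \<in> C \<and> v \<noteq> 0 \<and> tangent_vector C X v \<and> L = range (\<lambda>t. X + t *\<^sub>R v))
     \<or> asymptote C L"

text \<open>Law of reflection at \<open>X\<close> for the consecutive segments \<open>A X\<close> and \<open>X B\<close>. The vectors
  \<open>sgn (A - X)\<close> and \<open>sgn (B - X)\<close> are unit vectors. Equal components along the normal say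
  that the unoriented angles with the normal are congruent and that both segments are on the
  same side of the tangent; opposite components along the tangent say that the two segments
  lie symmetrically to the normal (excluding a mere reversal of \<open>A X\<close>, unless it is
  along the normal).\<close>

definition reflection_law :: "(real^2) set \<Rightarrow> real^2 \<Rightarrow> real^2 \<Rightarrow> real^2 \<Rightarrow> bool" where
  "reflection_law E A X B \<longleftrightarrow>
     (\<forall>n. normal_vector E X n \<longrightarrow> sgn (A - X) \<bullet> n = sgn (B - X) \<bullet> n) \<and>
     (\<forall>v. tangent_vector E X v \<longrightarrow> sgn (A - X) \<bullet> v = - (sgn (B - X) \<bullet> v))"

text \<open>A trajectory is given by its vertices \<open>P m\<close> in the order of motion; its \<open>m\<close>-th oriented
  segment goes from \<open>P m\<close> to \<open>P (m + 1)\<close>.\<close>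

definition billiard_trajectory :: "(real^2) set \<Rightarrow> (int \<Rightarrow> real^2) \<Rightarrow> bool" where
  "billiard_trajectory E P \<longleftrightarrow>
     (\<forall>m. P m \<in> E \<and> P m \<noteq> P (m + 1) \<and> reflection_law E (P (m - 1)) (P m) (P (m + 1)))"

definition side_line :: "(int \<Rightarrow> real^2) \<Rightarrow> int \<Rightarrow> (real^2) set" where
  "side_line P m = affine hull {P m, P (m + 1)}"

definition caustic :: "real^2 \<Rightarrow> real^2 \<Rightarrow> (int \<Rightarrow> real^2) \<Rightarrow> (real^2) set \<Rightarrow> bool" where
  "caustic F1 F2 P C \<longleftrightarrow>
     (ellipse_with_foci F1 F2 C \<or> hyperbola_with_foci F1 F2 C) \<and>
     (\<forall>m. tangent_line C (side_line P m))"

text \<open>Winding about an elliptic caustic is measured at its centre \<open>Z\<close>: the ray from \<open>Z\<close> to the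
  moving point turns counterclockwise, respectively clockwise.\<close>

definition winds_ccw :: "real^2 \<Rightarrow> (int \<Rightarrow> real^2) \<Rightarrow> bool" where
  "winds_ccw Z P \<longleftrightarrow> (\<forall>m. det2 (P m - Z) (P (m + 1) - Z) > 0)"

definition winds_cw :: "real^2 \<Rightarrow> (int \<Rightarrow> real^2) \<Rightarrow> bool" where
  "winds_cw Z P \<longleftrightarrow> (\<forall>m. det2 (P m - Z) (P (m + 1) - Z) < 0)"

definition same_winding :: "real^2 \<Rightarrow> (int \<Rightarrow> real^2) \<Rightarrow> (int \<Rightarrow> real^2) \<Rightarrow> bool" where
  "same_winding Z P Q \<longleftrightarrow>
     (winds_ccw Z P \<and> winds_ccw Z Q) \<or> (winds_cw Z P \<and> winds_cw Z Q)"

definition opposite_winding :: "real^2 \<Rightarrow> (int \<Rightarrow> real^2) \<Rightarrow> (int \<Rightarrow> real^2) \<Rightarrow> bool" where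
  "opposite_winding Z P Q \<longleftrightarrow>
     (winds_ccw Z P \<and> winds_cw Z Q) \<or> (winds_cw Z P \<and> winds_ccw Z Q)"

text \<open>The oriented segment from \<open>A\<close> to \<open>B\<close> crosses the line through \<open>F1\<close> and \<open>F2\<close> (the long
  axis, directed from \<open>F1\<close> to \<open>F2\<close>) from right to left.\<close>

definition crosses_long_axis :: "real^2 \<Rightarrow> real^2 \<Rightarrow> real^2 \<Rightarrow> real^2 \<Rightarrow> bool" where
  "crosses_long_axis F1 F2 A B \<longleftrightarrow>
     det2 (F2 - F1) (A - F1) < 0 \<and> det2 (F2 - F1) (B - F1) > 0"

definition same_crossing ::
  "real^2 \<Rightarrow> real^2 \<Rightarrow> (int \<Rightarrow> real^2) \<Rightarrow> (int \<Rightarrow> real^2) \<Rightarrow> int \<Rightarrow> bool" where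
  "same_crossing F1 F2 P Q m \<longleftrightarrow>
     (crosses_long_axis F1 F2 (P m) (P (m + 1)) \<and> crosses_long_axis F1 F2 (Q m) (Q (m + 1))) \<or>
     (crosses_long_axis F1 F2 (P (m + 1)) (P m) \<and> crosses_long_axis F1 F2 (Q (m + 1)) (Q m))"

end

theory Submission
  imports Defs
begin

text \<open>Work in the frame of the common axes, with foci \<open>(-c, 0)\<close>, \<open>(c, 0)\<close>, and encode an oriented
  line by its unit direction \<open>d\<close> and its moment \<open>p = d\<^sub>1 y - d\<^sub>2 x\<close>. It is tangent to the confocal conic
  of squared semi-axis \<open>k\<close> (or is an asymptote) iff \<open>p\<^sup>2 = k - c\<^sup>2 d\<^sub>1\<^sup>2\<close>. If \<open>(d, p)\<close> and
  \<open>(e, r)\<close> are two such lines, they meet on the confocal conic of squared semi-axis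
  \<open>\<kappa> = (c\<^sup>2 (d\<^sub>1 + e\<^sub>1)\<^sup>2 + (p + r)\<^sup>2) / \<bar>d + e\<bar>\<^sup>2\<close>, and \<open>\<kappa>\<close> is unchanged when both lines are
  reflected at their endpoints on the ellipse: a reflection sends the triple \<open>(d, p)\<close> to its
  negative plus a multiple of the tangent of the ellipse, and \<open>(d + e, p + r)\<close> is a linear combination
  of the two tangents involved. The type of the conic is decided by comparing \<open>\<kappa>\<close> with \<open>c\<^sup>2\<close>, which
  is the Cauchy--Schwarz inequality.\<close>

text \<open>The formula for \<open>\<kappa>\<close> is the tangency condition for the bisector
  \<open>(d + e, p + r)\<close>, taken as an unnormalised oriented line. It survives a reflection
  for the following reason. The dual form
  \<open>A s\<^sub>2\<^sup>2 + B s\<^sub>1\<^sup>2 - m\<^sup>2\<close> of the ellipse vanishes on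
  its tangents. The bisectors before and after are \<open>\<xi> T + \<eta> T'\<close> and
  \<open>\<xi>' T + \<eta>' T'\<close> in the same two tangents, so the form takes the values
  \<open>2 \<xi> \<eta> g\<close> and \<open>2 \<xi>' \<eta>' g\<close> with a common
  \<open>g\<close>. Since \<open>d\<close> and \<open>e\<close> are unit vectors,
  \<open>\<xi> \<xi>' |T|\<^sup>2 = \<eta> \<eta>' |T'|\<^sup>2\<close>, where only the direction
  parts are measured, and this makes the ratio of the form to the squared length of the bisector
  invariant. The shared caustic gives both trajectories the same Joachimsthal constant, and this is
  what makes the bisector a combination of the two tangents. The obstacles are the exceptional
  positions: coinciding heads, chords run through in opposite directions (where
  \<open>\<kappa>\<close> reads 0/0), and circles, where the equation of parameter 0 no longer cuts
  out a curve.\<close>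

section \<open>Reflecting a pair of oriented chords\<close>

text \<open>Here \<open>(N\<^sub>1, N\<^sub>2)\<close> is the normal \<open>(x/A, y/B)\<close> of the ellipse at \<open>(x, y)\<close>, so that
  \<open>(N\<^sub>2, -N\<^sub>1, 1)\<close> is the tangent there, and \<open>J\<close> is Joachimsthal's integral. Geometrically,
  the bisector of the two chords passes through the intersection of the tangents at their heads.\<close>

lemma bisector_combination:
  fixes A B J :: real
  assumes N: "A * N1\<^sup>2 + B * N2\<^sup>2 = 1" and M: "A * M1\<^sup>2 + B * M2\<^sup>2 = 1"
    and dN: "d1 * N1 + d2 * N2 = J" and eM: "e1 * M1 + e2 * M2 = J"
    and p: "p = d1 * (B * N2) - d2 * (A * N1)" and r: "r = e1 * (B * M2) - e2 * (A * M1)"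
    and AB: "A > 0" "B > 0" and ne: "N1 \<noteq> M1 \<or> N2 \<noteq> M2"
  obtains \<xi> \<eta> where "d1 + e1 = \<xi> * N2 + \<eta> * M2" "d2 + e2 = - (\<xi> * N1 + \<eta> * M1)" "p + r = \<xi> + \<eta>"
proof -
  \<comment> \<open>\<open>q\<close> is the value of either tangent at the other contact point. It
    is nonzero by strict convexity: \<open>- 2 * q\<close> is the squared difference of the normals
    in a positive definite form.\<close>
  define q where "q = A * N1 * M1 + B * N2 * M2 - 1"
  have "2 * q = - (A * (N1 - M1)\<^sup>2 + B * (N2 - M2)\<^sup>2)"
    unfolding q_def using N M by algebra
  moreover have "A * (N1 - M1)\<^sup>2 + B * (N2 - M2)\<^sup>2 > 0"
    using ne
  proof
    assume "N1 \<noteq> M1"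
    then have "A * (N1 - M1)\<^sup>2 > 0" "B * (N2 - M2)\<^sup>2 \<ge> 0" using AB by simp_all
    then show ?thesis by linarith
  next
    assume "N2 \<noteq> M2"
    then have "A * (N1 - M1)\<^sup>2 \<ge> 0" "B * (N2 - M2)\<^sup>2 > 0" using AB by simp_all
    then show ?thesis by linarith
  qed
  ultimately have q: "q \<noteq> 0" by linarith
  \<comment> \<open>Evaluate the triples at a head: the line and the tangent through that head
    vanish there, so only the other line and the other tangent contribute. This reads off the
    coefficients as \<open>\<xi>' / q\<close> and \<open>\<eta>' / q\<close>.\<close>
  define \<xi>' where "\<xi>' = d1 * (B * M2) - d2 * (A * M1) - p"
  define \<eta>' where "\<eta>' = e1 * (B * N2) - e2 * (A * N1) - r"
  have 1: "q * (d1 + e1) = \<xi>' * N2 + \<eta>' * M2"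
    unfolding q_def \<xi>'_def \<eta>'_def p r using N M dN eM by algebra
  have 2: "q * (d2 + e2) = - (\<xi>' * N1 + \<eta>' * M1)"
    unfolding q_def \<xi>'_def \<eta>'_def p r using N M dN eM by algebra
  have 3: "q * (p + r) = \<xi>' + \<eta>'"
    unfolding q_def \<xi>'_def \<eta>'_def p r using N M dN eM by algebra
  show ?thesis
  proof
    show "d1 + e1 = \<xi>' / q * N2 + \<eta>' / q * M2" "d2 + e2 = - (\<xi>' / q * N1 + \<eta>' / q * M1)" "p + r = \<xi>' / q + \<eta>' / q"
      using 1 2 3 q by (simp_all add: field_simps)
  qed
qed

text \<open>Here \<open>\<kappa>\<close> is a reflection coefficient, not the conic parameter:
  \<open>\<kappa> * (N2, - N1)\<close> is twice the orthogonal projection of \<open>d\<close> onto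
  the tangent direction. Both lines pass through the vertex \<open>(A * N1, B * N2)\<close>, where
  the vector \<open>(N2, - N1)\<close> has moment 1.\<close>

lemma reflected_sum:
  fixes A B J :: real
  assumes N: "A * N1\<^sup>2 + B * N2\<^sup>2 = 1"
    and d: "d1\<^sup>2 + d2\<^sup>2 = 1" and dN: "d1 * N1 + d2 * N2 = J" and dN': "d1' * N1 + d2' * N2 = - J"
    and refl: "d1' * N2 - d2' * N1 = d1 * N2 - d2 * N1"
    and p: "p = d1 * (B * N2) - d2 * (A * N1)" and p': "p' = d1' * (B * N2) - d2' * (A * N1)"
  defines "\<kappa> \<equiv> 2 * (d1 * N2 - d2 * N1) / (N1\<^sup>2 + N2\<^sup>2)"
  shows "d1 + d1' = \<kappa> * N2" "d2 + d2' = - (\<kappa> * N1)" "p + p' = \<kappa>"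
proof -
  have s: "N1\<^sup>2 + N2\<^sup>2 \<noteq> 0" using N by auto
  have sum: "(d1 + d1') * N1 + (d2 + d2') * N2 = 0"
    using dN dN' by (simp add: algebra_simps)
  have "(N1\<^sup>2 + N2\<^sup>2) * (d1 + d1') = 2 * (d1 * N2 - d2 * N1) * N2"
    using sum refl by algebra
  then show 1: "d1 + d1' = \<kappa> * N2" unfolding \<kappa>_def using s by (simp add: field_simps)
  have "(N1\<^sup>2 + N2\<^sup>2) * (d2 + d2') = - 2 * (d1 * N2 - d2 * N1) * N1"
    using sum refl by algebra
  then show 2: "d2 + d2' = - (\<kappa> * N1)" unfolding \<kappa>_def using s by (simp add: field_simps)
  show "p + p' = \<kappa>" unfolding p p' using 1 2 N by algebra
qed

lemma reflected_unit:
  fixes A B J :: real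
  assumes N: "A * N1\<^sup>2 + B * N2\<^sup>2 = 1"
    and d: "d1\<^sup>2 + d2\<^sup>2 = 1" and dN: "d1 * N1 + d2 * N2 = J" and dN': "d1' * N1 + d2' * N2 = - J"
    and refl: "d1' * N2 - d2' * N1 = d1 * N2 - d2 * N1"
  shows "d1'\<^sup>2 + d2'\<^sup>2 = 1"
proof -
  have s: "N1\<^sup>2 + N2\<^sup>2 \<noteq> 0" using N by auto
  have "(N1\<^sup>2 + N2\<^sup>2) * (d1'\<^sup>2 + d2'\<^sup>2) = (N1\<^sup>2 + N2\<^sup>2) * 1"
    using assms by algebra
  then show ?thesis using s mult_cancel_left by blast
qed

text \<open>The invariance is cross-multiplied so that it makes sense for antiparallel directions
  too. The second claim serves the circle, where bisectors through the centre must keep their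
  direction.\<close>

lemma reflected_pair_invariants:
  fixes A B J :: real
  assumes AB: "A > 0" "B > 0"
    and N: "A * N1\<^sup>2 + B * N2\<^sup>2 = 1" and M: "A * M1\<^sup>2 + B * M2\<^sup>2 = 1"
    and d: "d1\<^sup>2 + d2\<^sup>2 = 1" and dN: "d1 * N1 + d2 * N2 = J" and dN': "d1' * N1 + d2' * N2 = - J"
    and drefl: "d1' * N2 - d2' * N1 = d1 * N2 - d2 * N1"
    and e: "e1\<^sup>2 + e2\<^sup>2 = 1" and eM: "e1 * M1 + e2 * M2 = J" and eM': "e1' * M1 + e2' * M2 = - J"
    and erefl: "e1' * M2 - e2' * M1 = e1 * M2 - e2 * M1"
    and p: "p = d1 * (B * N2) - d2 * (A * N1)" and p': "p' = d1' * (B * N2) - d2' * (A * N1)"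
    and r: "r = e1 * (B * M2) - e2 * (A * M1)" and r': "r' = e1' * (B * M2) - e2' * (A * M1)"
  shows "((A - B) * (d1 + e1)\<^sup>2 + (p + r)\<^sup>2) * ((d1' + e1')\<^sup>2 + (d2' + e2')\<^sup>2)
       = ((A - B) * (d1' + e1')\<^sup>2 + (p' + r')\<^sup>2) * ((d1 + e1)\<^sup>2 + (d2 + e2)\<^sup>2)" (is ?inv)
    and "p + r = 0 \<Longrightarrow> p' + r' = 0 \<Longrightarrow> (d1 + e1) * (d2' + e2') = (d1' + e1') * (d2 + e2)" (is "_ \<Longrightarrow> _ \<Longrightarrow> ?par")
proof -
  define \<kappa> where "\<kappa> = 2 * (d1 * N2 - d2 * N1) / (N1\<^sup>2 + N2\<^sup>2)"
  define \<kappa>' where "\<kappa>' = 2 * (e1 * M2 - e2 * M1) / (M1\<^sup>2 + M2\<^sup>2)"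
  note dd = reflected_sum[OF N d dN dN' drefl p p', folded \<kappa>_def]
  note ee = reflected_sum[OF M e eM eM' erefl r r', folded \<kappa>'_def]
  have s: "N1\<^sup>2 + N2\<^sup>2 \<noteq> 0" "M1\<^sup>2 + M2\<^sup>2 \<noteq> 0" using N M by auto
  have k: "\<kappa> * (N1\<^sup>2 + N2\<^sup>2) = 2 * (d1 * N2 - d2 * N1)" "\<kappa>' * (M1\<^sup>2 + M2\<^sup>2) = 2 * (e1 * M2 - e2 * M1)"
    using s unfolding \<kappa>_def \<kappa>'_def by auto
  have "?inv \<and> (p + r = 0 \<longrightarrow> p' + r' = 0 \<longrightarrow> ?par)"
  proof (cases "N1 \<noteq> M1 \<or> N2 \<noteq> M2")
    case True
    obtain \<xi> \<eta> where w: "d1 + e1 = \<xi> * N2 + \<eta> * M2" "d2 + e2 = - (\<xi> * N1 + \<eta> * M1)" "p + r = \<xi> + \<eta>"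
      using bisector_combination[OF N M dN eM p r AB True] by blast
    define \<xi>' \<eta>' where "\<xi>' = \<kappa> - \<xi>" and "\<eta>' = \<kappa>' - \<eta>"
    have w': "d1' + e1' = \<xi>' * N2 + \<eta>' * M2" "d2' + e2' = - (\<xi>' * N1 + \<eta>' * M1)" "p' + r' = \<xi>' + \<eta>'"
      using w dd ee unfolding \<xi>'_def \<eta>'_def by algebra+
    \<comment> \<open>Unit vectors make \<open>d + e\<close> orthogonal to \<open>d - e\<close>;
      written in the two tangent directions this is the balance \<open>bal\<close>.\<close>
    have "(d1 + e1) * (d1 - e1) + (d2 + e2) * (d2 - e2) = 0"
      using d e by algebra
    then have bal: "\<xi> * \<xi>' * (N1\<^sup>2 + N2\<^sup>2) = \<eta> * \<eta>' * (M1\<^sup>2 + M2\<^sup>2)"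
      unfolding \<xi>'_def \<eta>'_def using w(1,2) k by algebra
    \<comment> \<open>On combinations of tangents the dual form keeps only its cross term. Hence
      \<open>2 * (A * N1 * M1 + B * N2 * M2 - 1)\<close> times this product is the difference of the
      two sides of the next equation.\<close>
    have "(\<eta> * \<xi>' - \<xi> * \<eta>') * (\<xi> * \<xi>' * (N1\<^sup>2 + N2\<^sup>2) - \<eta> * \<eta>' * (M1\<^sup>2 + M2\<^sup>2)) = 0"
      using bal by simp
    then have "(A * (d2 + e2)\<^sup>2 + B * (d1 + e1)\<^sup>2 - (p + r)\<^sup>2) * ((d1' + e1')\<^sup>2 + (d2' + e2')\<^sup>2)
       = (A * (d2' + e2')\<^sup>2 + B * (d1' + e1')\<^sup>2 - (p' + r')\<^sup>2) * ((d1 + e1)\<^sup>2 + (d2 + e2)\<^sup>2)"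
      unfolding w w' using N M by algebra
    \<comment> \<open>For a bisector \<open>(s\<^sub>1, s\<^sub>2, m)\<close>,
      \<open>(A - B) s\<^sub>1\<^sup>2 + m\<^sup>2\<close> is
      \<open>A (s\<^sub>1\<^sup>2 + s\<^sub>2\<^sup>2)\<close> minus the dual form.\<close>
    then have ?inv by algebra
    \<comment> \<open>Zero total moments mean \<open>\<eta> = - \<xi>\<close> and
      \<open>\<eta>' = - \<xi>'\<close>, so both bisectors are multiples of the difference of the
      two tangents.\<close>
    moreover have ?par if "p + r = 0" "p' + r' = 0"
      using w w' that by algebra
    ultimately show ?thesis by blast
  next
    case False
    then have NM: "M1 = N1" "M2 = N2" by auto
    \<comment> \<open>Unit vectors with the same component along the common normal are equal or
      mirror images in it.\<close>
    have kk: "(d1 * N2 - d2 * N1)\<^sup>2 = (e1 * N2 - e2 * N1)\<^sup>2"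
      using d e dN eM unfolding NM by algebra
    consider "d1 * N2 - d2 * N1 = e1 * N2 - e2 * N1" | "d1 * N2 - d2 * N1 = - (e1 * N2 - e2 * N1)"
      using kk power2_eq_iff by blast
    then show ?thesis
    proof cases
      case 1
      have "(N1\<^sup>2 + N2\<^sup>2) * (d1 - e1) = 0" "(N1\<^sup>2 + N2\<^sup>2) * (d2 - e2) = 0"
        using 1 dN eM unfolding NM by algebra+
      then have de: "e1 = d1" "e2 = d2" using s by auto
      have "(N1\<^sup>2 + N2\<^sup>2) * (d1' - e1') = 0" "(N1\<^sup>2 + N2\<^sup>2) * (d2' - e2') = 0"
        using 1 dN' eM' drefl erefl unfolding NM by algebra+
      then have de': "e1' = d1'" "e2' = d2'" using s by auto
      have pr: "r = p" "r' = p'" using p r p' r' de de' NM by auto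
      have d': "d1'\<^sup>2 + d2'\<^sup>2 = 1" using reflected_unit[OF N d dN dN' drefl] .
      \<comment> \<open>For coinciding chords the invariant is the caustic parameter itself,
        expressed through \<open>J\<close>.\<close>
      have "(A - B) * d1\<^sup>2 + p\<^sup>2 = A - A * B * J\<^sup>2" 
        unfolding p using N d dN  by algebra
      moreover have "(A - B) * d1'\<^sup>2 + p'\<^sup>2 = A - A * B * J\<^sup>2" 
        unfolding p' using N d' dN'  by algebra
      ultimately have ?inv unfolding de de' pr using d d' by algebra
      moreover have ?par if "p + r = 0" "p' + r' = 0"
      proof -
        have "p = 0" "p' = 0" using that pr by auto
        then have "\<kappa> = 0" using dd by auto
        then have "d1' = - d1" "d2' = - d2" using dd by auto
        then show ?thesis using de de' by simp
      qed
      ultimately show ?thesis by blast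
    next
      case 2
      then have "\<kappa>' = - \<kappa>" unfolding \<kappa>_def \<kappa>'_def NM by (simp only: mult_minus_right minus_divide_left minus_minus)
      then have *: "d1' + e1' = - (d1 + e1)" "d2' + e2' = - (d2 + e2)" "p' + r' = - (p + r)"
        using dd ee NM by (auto simp: algebra_simps)
      show ?thesis unfolding * by (simp del: minus_add_distrib)
    qed
  qed
  then show ?inv "p + r = 0 \<Longrightarrow> p' + r' = 0 \<Longrightarrow> ?par" by auto
qed

text \<open>The second hypothesis is needed because \<open>(f, g)\<close> vanishes where two chords coincide with opposite
  orientations; the ratio is then carried over to the other side by symmetry.\<close>

lemma proportional_forward:
  fixes f g :: "int \<Rightarrow> real"
  assumes step: "\<And>m. f m * g (m + 1) = f (m + 1) * g m"
    and jump: "\<And>m. f m = 0 \<Longrightarrow> g m = 0 \<Longrightarrow> \<exists>\<sigma>. \<sigma> \<noteq> 0 \<and> f (m - 1) = \<sigma> * f (m + 1) \<and> g (m - 1) = \<sigma> * g (m + 1)"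
    and nz: "f k \<noteq> 0 \<or> g k \<noteq> 0"
  shows "f k * g (k + int n) = f (k + int n) * g k"
proof -
  define Z where "Z m \<longleftrightarrow> f m = 0 \<and> g m = 0" for m
  have tr: "f k * g b = f b * g k" if "f k * g a = f a * g k" "f a * g b = f b * g a" "\<not> Z a" for a b
  proof -
    have "g a * (f k * g b) = g a * (f b * g k)" "f a * (f k * g b) = f a * (f b * g k)"
      using that by algebra+
    then show ?thesis using that(3) unfolding Z_def by auto
  qed
  \<comment> \<open>The induction carries two consecutive indices: where \<open>f\<close> and
    \<open>g\<close> both vanish, \<open>step\<close> says nothing and the relation is moved two
    places by \<open>jump\<close>. The last conjunct says that such zeros are never
    adjacent.\<close>
  have "f k * g (k + int n) = f (k + int n) * g k \<and> f k * g (k + int n + 1) = f (k + int n + 1) * g k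
      \<and> \<not> (Z (k + int n) \<and> Z (k + int n + 1))"
  proof (induction n)
    case 0
    then show ?case using nz step[of k] by (auto simp: Z_def)
  next
    case (Suc n)
    define a where "a = k + int n"
    have a: "k + int (Suc n) = a + 1" unfolding a_def by simp
    have IH: "f k * g a = f a * g k" "f k * g (a + 1) = f (a + 1) * g k" "\<not> (Z a \<and> Z (a + 1))"
      using Suc unfolding a_def by auto
    show ?case
    proof (cases "Z (a + 1)")
      case True
      then obtain \<sigma> where s: "\<sigma> \<noteq> 0" "f a = \<sigma> * f (a + 1 + 1)" "g a = \<sigma> * g (a + 1 + 1)"
        using jump[of "a + 1"] unfolding Z_def by auto
      then have "\<not> Z (a + 1 + 1)" using IH True unfolding Z_def by auto
      moreover have "\<sigma> * (f k * g (a + 1 + 1)) = \<sigma> * (f (a + 1 + 1) * g k)"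
        using IH(1) s by algebra
      ultimately show ?thesis unfolding a using IH s by simp
    next
      case False
      then show ?thesis unfolding a using tr[OF IH(2) step] IH by blast
    qed
  qed
  then show ?thesis by blast
qed

text \<open>The hypotheses are stable under \<open>m \<mapsto> - m\<close>, with
  \<open>\<sigma>\<close> replaced by its inverse; this reaches the indices below
  \<open>k\<close>.\<close>

lemma proportional_chain:
  fixes f g :: "int \<Rightarrow> real"
  assumes step: "\<And>m. f m * g (m + 1) = f (m + 1) * g m"
    and jump: "\<And>m. f m = 0 \<Longrightarrow> g m = 0 \<Longrightarrow> \<exists>\<sigma>. \<sigma> \<noteq> 0 \<and> f (m - 1) = \<sigma> * f (m + 1) \<and> g (m - 1) = \<sigma> * g (m + 1)"
    and nz: "f k \<noteq> 0 \<or> g k \<noteq> 0"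
  shows "f k * g m = f m * g k"
proof (cases "m \<ge> k")
  case True
  then show ?thesis using proportional_forward[of f g k "nat (m - k)"] assms by auto
next
  case False
  have "\<exists>\<sigma>. \<sigma> \<noteq> 0 \<and> f (- (m - 1)) = \<sigma> * f (- (m + 1)) \<and> g (- (m - 1)) = \<sigma> * g (- (m + 1))"
    if z: "f (- m) = 0" "g (- m) = 0" for m
  proof -
    obtain \<sigma> where "\<sigma> \<noteq> 0" "f (- m - 1) = \<sigma> * f (- m + 1)" "g (- m - 1) = \<sigma> * g (- m + 1)"
      using jump[OF z] by auto
    moreover have "- (m - 1) = - m + 1" "- (m + 1) = - m - 1" by auto
    ultimately show ?thesis by (intro exI[of _ "inverse \<sigma>"]) simp
  qed
  moreover have "f (- m) * g (- (m + 1)) = f (- (m + 1)) * g (- m)" for m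
    using step[of "- (m + 1)"] by simp
  ultimately have "f (- (- k)) * g (- (- k + int n)) = f (- (- k + int n)) * g (- (- k))" for n
    using proportional_forward[of "\<lambda>m. f (- m)" "\<lambda>m. g (- m)" "- k" n] nz by auto
  from this[of "nat (k - m)"] False show ?thesis by simp
qed


section \<open>Pairs of billiard paths and the invariant\<close>

text \<open>\<open>tail\<close> and \<open>head\<close> with a single \<open>J\<close> encode the
  caustic and also the reversal of the normal component at each vertex, so \<open>reflect\<close>
  states the tangential component only. \<open>moment_eq\<close> puts both endpoints on one line of
  direction \<open>d\<close>.\<close>

locale billiard_path =
  fixes A B J :: real and N1 N2 d1 d2 :: "int \<Rightarrow> real"
  assumes AB: "A > 0" "B > 0"
    and on_ellipse: "A * (N1 m)\<^sup>2 + B * (N2 m)\<^sup>2 = 1"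
    and unit: "(d1 m)\<^sup>2 + (d2 m)\<^sup>2 = 1"
    and tail: "d1 m * N1 m + d2 m * N2 m = - J"
    and head: "d1 m * N1 (m + 1) + d2 m * N2 (m + 1) = J"
    and moment_eq: "d1 m * (B * N2 m) - d2 m * (A * N1 m) = d1 m * (B * N2 (m + 1)) - d2 m * (A * N1 (m + 1))"
    and reflect: "d1 (m + 1) * N2 (m + 1) - d2 (m + 1) * N1 (m + 1) = d1 m * N2 (m + 1) - d2 m * N1 (m + 1)"
begin

definition moment :: "int \<Rightarrow> real" where
  "moment m = d1 m * (B * N2 m) - d2 m * (A * N1 m)"

lemma moment_head: "moment m = d1 m * (B * N2 (m + 1)) - d2 m * (A * N1 (m + 1))"
  unfolding moment_def by (rule moment_eq)

end

locale billiard_path_pair =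
  P: billiard_path A B J N1 N2 d1 d2 + Q: billiard_path A B J M1 M2 e1 e2
  for A B J N1 N2 d1 d2 M1 M2 e1 e2
begin

text \<open>Reversibility of the motion: on the same chord run backwards, the head of one segment is
  the tail of the other, so the next segment of one path is the previous segment of the other,
  reversed.\<close>

lemma reversed_chord:
  assumes "d1 m = - e1 m" "d2 m = - e2 m" "P.moment m = - Q.moment m"
  shows "d1 (m + 1) = - e1 (m - 1)" "d2 (m + 1) = - e2 (m - 1)" "P.moment (m + 1) = - Q.moment (m - 1)"
proof -
  \<comment> \<open>The difference of the two normals solves a homogeneous linear system, from
    \<open>J\<close> and from incidence, with positive determinant
    \<open>B * (e1 m)\<^sup>2 + A * (e2 m)\<^sup>2\<close>.\<close>
  define x where "x = N1 (m + 1) - M1 m"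
  define y where "y = N2 (m + 1) - M2 m"
  have eqs: "e1 m * x + e2 m * y = 0" "e1 m * (B * y) - e2 m * (A * x) = 0"
    using P.head[of m] Q.tail[of m] P.moment_head[of m] Q.moment_def[of m]
    unfolding x_def y_def assms by (simp_all add: algebra_simps)
  have pos: "B * (e1 m)\<^sup>2 + A * (e2 m)\<^sup>2 \<noteq> 0"
  proof -
    have "e1 m \<noteq> 0 \<or> e2 m \<noteq> 0" using Q.unit[of m] by auto
    then have "B * (e1 m)\<^sup>2 > 0 \<or> A * (e2 m)\<^sup>2 > 0" using P.AB by auto
    moreover have "B * (e1 m)\<^sup>2 \<ge> 0" "A * (e2 m)\<^sup>2 \<ge> 0" using P.AB by auto
    ultimately show ?thesis by linarith
  qed
  have "(B * (e1 m)\<^sup>2 + A * (e2 m)\<^sup>2) * x = 0" "(B * (e1 m)\<^sup>2 + A * (e2 m)\<^sup>2) * y = 0"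
    using eqs by algebra+
  then have NM: "N1 (m + 1) = M1 m" "N2 (m + 1) = M2 m"
    using pos unfolding x_def y_def by auto
  have s: "(M1 m)\<^sup>2 + (M2 m)\<^sup>2 \<noteq> 0" using Q.on_ellipse[of m] by auto
  define x' where "x' = d1 (m + 1) + e1 (m - 1)"
  define y' where "y' = d2 (m + 1) + e2 (m - 1)"
  have "x' * M1 m + y' * M2 m = 0"
    using P.tail[of "m + 1"] Q.head[of "m - 1"] unfolding x'_def y'_def NM
    by (simp add: algebra_simps)
  moreover have "x' * M2 m - y' * M1 m = 0"
    using P.reflect[of m] Q.reflect[of "m - 1"] assms unfolding x'_def y'_def NM
    by (simp add: algebra_simps)
  ultimately have "((M1 m)\<^sup>2 + (M2 m)\<^sup>2) * x' = 0" "((M1 m)\<^sup>2 + (M2 m)\<^sup>2) * y' = 0"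
    by algebra+
  then have "x' = 0" "y' = 0" using s by auto
  then show *: "d1 (m + 1) = - e1 (m - 1)" "d2 (m + 1) = - e2 (m - 1)"
    unfolding x'_def y'_def by auto
  show "P.moment (m + 1) = - Q.moment (m - 1)"
    unfolding P.moment_def Q.moment_head * NM by simp
qed

text \<open>The conic parameter is \<open>conic_num m / conic_den m\<close>. The parts are kept
  separate because the denominator vanishes for antiparallel segments, and both vanish for a
  reversed chord.\<close>

definition conic_num :: "int \<Rightarrow> real" where
  "conic_num m = (A - B) * (d1 m + e1 m)\<^sup>2 + (P.moment m + Q.moment m)\<^sup>2"

definition conic_den :: "int \<Rightarrow> real" where
  "conic_den m = (d1 m + e1 m)\<^sup>2 + (d2 m + e2 m)\<^sup>2"

lemma conic_step: "conic_num m * conic_den (m + 1) = conic_num (m + 1) * conic_den m"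
  unfolding conic_num_def conic_den_def
  by (rule reflected_pair_invariants(1)[OF P.AB P.on_ellipse Q.on_ellipse P.unit P.head P.tail P.reflect Q.unit Q.head Q.tail Q.reflect
     P.moment_head P.moment_def Q.moment_head Q.moment_def])

lemma parallel_step:
  assumes "P.moment m + Q.moment m = 0" "P.moment (m + 1) + Q.moment (m + 1) = 0"
  shows "(d1 m + e1 m) * (d2 (m + 1) + e2 (m + 1)) = (d1 (m + 1) + e1 (m + 1)) * (d2 m + e2 m)"
  using assms
  by (rule reflected_pair_invariants(2)[OF P.AB P.on_ellipse Q.on_ellipse P.unit P.head P.tail P.reflect Q.unit Q.head Q.tail Q.reflect
     P.moment_head P.moment_def Q.moment_head Q.moment_def])

text \<open>\<open>reversed_chord\<close> with the two paths in either order: the segments on one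
  side of the common chord are those on the other side, exchanged and reversed.\<close>

lemma sum_after_reversal:
  assumes "d1 m + e1 m = 0" "d2 m + e2 m = 0" "P.moment m + Q.moment m = 0"
  shows "d1 (m - 1) + e1 (m - 1) = - (d1 (m + 1) + e1 (m + 1))"
    "d2 (m - 1) + e2 (m - 1) = - (d2 (m + 1) + e2 (m + 1))"
    "P.moment (m - 1) + Q.moment (m - 1) = - (P.moment (m + 1) + Q.moment (m + 1))"
proof -
  interpret QP: billiard_path_pair A B J M1 M2 e1 e2 N1 N2 d1 d2 ..
  show "d1 (m - 1) + e1 (m - 1) = - (d1 (m + 1) + e1 (m + 1))"
    "d2 (m - 1) + e2 (m - 1) = - (d2 (m + 1) + e2 (m + 1))"
    "P.moment (m - 1) + Q.moment (m - 1) = - (P.moment (m + 1) + Q.moment (m + 1))"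
    using reversed_chord[of m] QP.reversed_chord[of m] assms by auto
qed

lemma conic_zero:
  assumes "conic_num m = 0" "conic_den m = 0"
  shows "d1 m + e1 m = 0" "d2 m + e2 m = 0" "P.moment m + Q.moment m = 0"
proof -
  show *: "d1 m + e1 m = 0" "d2 m + e2 m = 0"
    using assms(2) unfolding conic_den_def by (simp_all add: sum_power2_eq_zero_iff)
  show "P.moment m + Q.moment m = 0"
    using assms(1) * unfolding conic_num_def by simp
qed

lemma conic_invariant:
  assumes "conic_den k \<noteq> 0"
  shows "conic_num k * conic_den m = conic_num m * conic_den k"
proof (rule proportional_chain)
  fix m assume z: "conic_num m = 0" "conic_den m = 0"
  show "\<exists>\<sigma>. \<sigma> \<noteq> 0 \<and> conic_num (m - 1) = \<sigma> * conic_num (m + 1) \<and> conic_den (m - 1) = \<sigma> * conic_den (m + 1)"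
    \<comment> \<open>Both quantities are quadratic in the sums, so the sign produced by the
      reversal disappears and \<open>\<sigma>\<close> is 1.\<close>
    unfolding conic_num_def conic_den_def sum_after_reversal[OF conic_zero[OF z]] by (intro exI[of _ 1]) (simp del: minus_add_distrib)
qed (use conic_step assms in auto)

text \<open>For a circle whose bisectors all pass through the centre, this makes them one and the
  same diameter. The sums enter linearly, so a reversed chord gives
  \<open>\<sigma> = - 1\<close>.\<close>

lemma parallel_invariant:
  assumes "\<And>m. P.moment m + Q.moment m = 0" and k: "conic_den k \<noteq> 0"
  shows "(d1 k + e1 k) * (d2 m + e2 m) = (d1 m + e1 m) * (d2 k + e2 k)"
proof (rule proportional_chain)
  fix m assume "d1 m + e1 m = 0" "d2 m + e2 m = 0"
  from sum_after_reversal[OF this assms(1)]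
  show "\<exists>\<sigma>. \<sigma> \<noteq> 0 \<and> d1 (m - 1) + e1 (m - 1) = \<sigma> * (d1 (m + 1) + e1 (m + 1)) \<and> d2 (m - 1) + e2 (m - 1) = \<sigma> * (d2 (m + 1) + e2 (m + 1))"
    by (intro exI[of _ "- 1"]) simp
qed (use parallel_step assms conic_den_def in auto)

end


section \<open>The intersection point and the type of its conic\<close>

text \<open>Geometrically, the bisectors of the two tangents from a point to a conic touch the
  confocal conics through that point. \<open>K\<close> is the parameter of the conic touched by the
  bisector \<open>(d + e, p + r)\<close>.\<close>

lemma intersection_on_conic:
  fixes x y :: real
  assumes d: "d1\<^sup>2 + d2\<^sup>2 = 1" and e: "e1\<^sup>2 + e2\<^sup>2 = 1"
    and p: "d1 * y - d2 * x = p" and r: "e1 * y - e2 * x = r"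
    and p2: "p\<^sup>2 = k - cc * d1\<^sup>2" and r2: "r\<^sup>2 = k - cc * e1\<^sup>2"
    and K: "cc * (d1 + e1)\<^sup>2 + (p + r)\<^sup>2 = K * ((d1 + e1)\<^sup>2 + (d2 + e2)\<^sup>2)"
    and nz: "d1 * e2 - d2 * e1 \<noteq> 0"
  shows "(K - cc) * x\<^sup>2 + K * y\<^sup>2 = K * (K - cc)"
proof -
  define t where "t = d1 * e1 + d2 * e2"
  define S where "S = cc * d1 * e1 + p * r + k"
  have S: "K * (1 + t) = S"
  proof -
    have "(d1 + e1)\<^sup>2 + (d2 + e2)\<^sup>2 = 2 * (1 + t)" unfolding t_def using d e by algebra
    moreover have "cc * (d1 + e1)\<^sup>2 + (p + r)\<^sup>2 = 2 * S" unfolding S_def using p2 r2 by algebra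
    ultimately have "K * (2 * (1 + t)) = 2 * S" using K by metis
    then show ?thesis by (simp add: algebra_simps)
  qed
  have det2: "(d1 * e2 - d2 * e1)\<^sup>2 = 1 - t\<^sup>2"
    unfolding t_def using d e by algebra
  have x: "(d1 * e2 - d2 * e1) * x = p * e1 - r * d1" and y: "(d1 * e2 - d2 * e1) * y = p * e2 - r * d2"
    unfolding p[symmetric] r[symmetric] by algebra+
  have sq: "(d1 + e1)\<^sup>2 = (1 + t) * (1 + d1 * e1 - d2 * e2)"
    unfolding t_def using d e by algebra
  have 1: "(p * e1 - r * d1)\<^sup>2 + (p * e2 - r * d2)\<^sup>2 = p\<^sup>2 + r\<^sup>2 - 2 * p * r * t"
    unfolding t_def using d e by algebra
  have "K * (p\<^sup>2 + r\<^sup>2 - 2 * p * r * t + cc * (1 - t\<^sup>2) - 2 * S) = K * (cc * (1 - t\<^sup>2) - cc * (d1 + e1)\<^sup>2 - 2 * p * r * (1 + t))"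
    unfolding S_def using p2 r2 by algebra
  also have "\<dots> = S * (cc * (1 - t) - cc * (1 + d1 * e1 - d2 * e2) - 2 * p * r)"
    unfolding sq S[symmetric] by algebra
  also have "\<dots> = S * (- 2 * cc * d1 * e1 - 2 * p * r)" unfolding t_def by algebra
  finally have 2: "K * (p\<^sup>2 + r\<^sup>2 - 2 * p * r * t + cc * (1 - t\<^sup>2) - 2 * S) = S * (2 * k - 2 * S)"
    unfolding S_def by algebra
  have 3: "S * (2 * k - 2 * S) + S\<^sup>2 = cc * (p * e1 - r * d1)\<^sup>2"
    unfolding S_def using p2 r2 by algebra
  \<comment> \<open>Cramer's rule gives \<open>x\<close> and \<open>y\<close> up to the determinant,
    so the conic equation is multiplied by its square \<open>1 - t\<^sup>2\<close>, with
    \<open>t\<close> the cosine of the angle between the lines.\<close>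
  have "(d1 * e2 - d2 * e1)\<^sup>2 * ((K - cc) * x\<^sup>2 + K * y\<^sup>2 - K * (K - cc))
    = (K - cc) * (p * e1 - r * d1)\<^sup>2 + K * (p * e2 - r * d2)\<^sup>2 - K * (K - cc) * (1 - t\<^sup>2)"
    unfolding x[symmetric] y[symmetric] det2[symmetric] by algebra
  also have "\<dots> = 0"
  proof -
    have "K * (K * (1 - t\<^sup>2)) = 2 * K * S - S\<^sup>2" unfolding S[symmetric] by algebra
    moreover define a b U where "a = (p * e1 - r * d1)\<^sup>2" and "b = (p * e2 - r * d2)\<^sup>2" and "U = p\<^sup>2 + r\<^sup>2 - 2 * p * r * t"
    ultimately show ?thesis using 1 2 3 unfolding a_def[symmetric] b_def[symmetric] U_def[symmetric] by algebra
  qed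
  finally show ?thesis using nz by simp
qed

text \<open>Cauchy--Schwarz gives \<open>\<bar>p * r\<bar> \<ge> c2 * \<bar>x * y\<bar> + b\<close>.
  It is applied with \<open>b = k - c\<^sup>2\<close> and the second components of the directions.
  Equality can remain only for opposite windings, where it yields the long axis.\<close>

lemma elliptic_caustic_sign:
  fixes p :: real
  assumes p2: "p\<^sup>2 = b + c2 * x\<^sup>2" and r2: "r\<^sup>2 = b + c2 * y\<^sup>2" and "c2 \<ge> 0" "b > 0"
  shows "p * r > 0 \<Longrightarrow> c2 * x * y - b < p * r" and "p * r < 0 \<Longrightarrow> p * r \<le> c2 * x * y - b"
proof -
  have "(p * r)\<^sup>2 - (c2 * \<bar>x * y\<bar> + b)\<^sup>2 = b * c2 * (\<bar>x\<bar> - \<bar>y\<bar>)\<^sup>2"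
  proof -
    have "(p * r)\<^sup>2 = (b + c2 * \<bar>x\<bar>\<^sup>2) * (b + c2 * \<bar>y\<bar>\<^sup>2)" using p2 r2 by (simp add: power_mult_distrib)
    then show ?thesis unfolding abs_mult by algebra
  qed
  then have 1: "(c2 * \<bar>x * y\<bar> + b)\<^sup>2 \<le> (p * r)\<^sup>2" using assms by (smt (verit) mult_nonneg_nonneg zero_le_power2)
  then have *: "c2 * \<bar>x * y\<bar> + b \<le> \<bar>p * r\<bar>" using abs_le_square_iff[THEN iffD2, OF 1] by linarith
  have **: "c2 * x * y \<le> c2 * \<bar>x * y\<bar>" "- (c2 * x * y) \<le> c2 * \<bar>x * y\<bar>"
    using mult_left_mono[OF abs_ge_self[of "x * y"] \<open>c2 \<ge> 0\<close>] mult_left_mono[OF abs_ge_minus_self[of "x * y"] \<open>c2 \<ge> 0\<close>]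
    by (simp_all add: mult.assoc)
  show "p * r > 0 \<Longrightarrow> c2 * x * y - b < p * r" "p * r < 0 \<Longrightarrow> p * r \<le> c2 * x * y - b"
    using * ** \<open>b > 0\<close> by linarith+
qed

text \<open>The reversed Cauchy--Schwarz inequality for an indefinite form, with
  \<open>b = c\<^sup>2 - k\<close>. It applies because the squares \<open>p\<^sup>2\<close> and
  \<open>r\<^sup>2\<close> force \<open>c2 * x\<^sup>2 \<ge> b\<close> and
  \<open>c2 * y\<^sup>2 \<ge> b\<close>.\<close>

lemma hyperbolic_caustic_sign:
  fixes p :: real
  assumes p2: "p\<^sup>2 = c2 * x\<^sup>2 - b" and r2: "r\<^sup>2 = c2 * y\<^sup>2 - b" and "c2 > 0" "b > 0"
  shows "x * y > 0 \<Longrightarrow> p * r < c2 * x * y + b" and "x * y < 0 \<Longrightarrow> c2 * x * y + b \<le> p * r"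
proof -
  have "(c2 * \<bar>x * y\<bar> - b)\<^sup>2 - (p * r)\<^sup>2 = b * c2 * (\<bar>x\<bar> - \<bar>y\<bar>)\<^sup>2"
  proof -
    have "(p * r)\<^sup>2 = (c2 * \<bar>x\<bar>\<^sup>2 - b) * (c2 * \<bar>y\<bar>\<^sup>2 - b)" using p2 r2 by (simp add: power_mult_distrib)
    then show ?thesis unfolding abs_mult by algebra
  qed
  then have 1: "(p * r)\<^sup>2 \<le> (c2 * \<bar>x * y\<bar> - b)\<^sup>2" using assms by (smt (verit) mult_nonneg_nonneg zero_le_power2)
  have "c2 * x\<^sup>2 \<ge> b" "c2 * y\<^sup>2 \<ge> b" using p2 r2 by (smt (verit) zero_le_power2)+
  then have "b * b \<le> (c2 * x\<^sup>2) * (c2 * y\<^sup>2)" using assms by (intro mult_mono) auto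
  also have "\<dots> = (c2 * \<bar>x * y\<bar>)\<^sup>2" by (simp add: power2_eq_square)
  finally have "b\<^sup>2 \<le> (c2 * \<bar>x * y\<bar>)\<^sup>2" unfolding power2_eq_square[of b] .
  then have "b \<le> c2 * \<bar>x * y\<bar>" by (rule power2_le_imp_le) (simp add: \<open>c2 > 0\<close> less_imp_le)
  then have *: "\<bar>p * r\<bar> \<le> c2 * \<bar>x * y\<bar> - b" using abs_le_square_iff[THEN iffD2, OF 1] by linarith
  show "p * r < c2 * x * y + b" if "x * y > 0" 
    using * that \<open>b > 0\<close> by (simp add: mult.assoc)
  show "c2 * x * y + b \<le> p * r" if "x * y < 0"
    using * that \<open>b > 0\<close> by (simp add: mult.assoc)
qed

lemma affine_hull_2_line:
  fixes P P' :: "'a::real_normed_vector"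
  shows "affine hull {P, P'} = range (\<lambda>t. P + t *\<^sub>R sgn (P' - P))"
proof (cases "P = P'")
  case True
  then show ?thesis by auto
next
  case False
  define l where "l = norm (P' - P)"
  have l: "l \<noteq> 0" "P' - P = l *\<^sub>R sgn (P' - P)"
    using False unfolding l_def by (auto simp: sgn_div_norm)
  have scale: "t *\<^sub>R (P' - P) = (t * l) *\<^sub>R sgn (P' - P)" for t
    by (subst l(2)) simp
  show ?thesis
  proof safe
    fix X assume "X \<in> affine hull {P, P'}"
    then obtain a b where ab: "a + b = 1" "X = a *\<^sub>R P + b *\<^sub>R P'" unfolding affine_hull_2 by blast
    then have a: "a = 1 - b" by linarith
    have "X = P + b *\<^sub>R (P' - P)" unfolding ab(2) a by (simp add: algebra_simps)
    then show "X \<in> range (\<lambda>t. P + t *\<^sub>R sgn (P' - P))" unfolding scale by blast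
  next
    fix t
    have "P + t *\<^sub>R sgn (P' - P) = P + (t / l) *\<^sub>R (P' - P)" unfolding scale using l(1) by simp
    also have "\<dots> = (1 - t / l) *\<^sub>R P + (t / l) *\<^sub>R P'" by (simp add: algebra_simps)
    finally show "P + t *\<^sub>R sgn (P' - P) \<in> affine hull {P, P'}" 
      unfolding affine_hull_2 by (intro CollectI exI[of _ "1 - t / l"] exI[of _ "t / l"]) auto
  qed
qed

section \<open>Asymptotes, tangents and chords in coordinates\<close>

text \<open>In the asymptotic coordinates \<open>U\<close>, \<open>V\<close> the product
  \<open>U * V\<close> is constant while \<open>U\<^sup>2 + V\<^sup>2\<close> diverges. If the form
  \<open>\<rho> * U + \<sigma> * V\<close> has both coefficients nonzero, its square differs from a
  divergent sum by a constant. If one coefficient vanishes, a nonzero limit would make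
  \<open>U\<close> and \<open>V\<close> both converge. So the line is parallel to an asymptote and
  \<open>p = 0\<close>.\<close>

lemma hyperbola_asymptote_moment:
  fixes x y :: "nat \<Rightarrow> real"
  assumes k: "k > 0" "\<beta> < 0" and on: "\<And>n. \<beta> * (x n)\<^sup>2 + k * (y n)\<^sup>2 = k * \<beta>"
    and inf: "filterlim (\<lambda>n. (x n)\<^sup>2 + (y n)\<^sup>2) at_top sequentially"
    and d: "d1\<^sup>2 + d2\<^sup>2 = 1" and lim: "(\<lambda>n. d1 * y n - d2 * x n) \<longlonglongrightarrow> p"
  shows "p\<^sup>2 = \<beta> * d1\<^sup>2 + k * d2\<^sup>2"
proof -
  define a b where "a = sqrt k" and "b = sqrt (- \<beta>)"
  have ab: "a > 0" "b > 0" "k = a\<^sup>2" "\<beta> = - b\<^sup>2" using k unfolding a_def b_def by auto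
  define U V where "U n = b * x n - a * y n" and "V n = b * x n + a * y n" for n
  define \<rho> \<sigma> where "\<rho> = - (b * d1 + a * d2) / (2 * a * b)" and "\<sigma> = (b * d1 - a * d2) / (2 * a * b)"
  define h where "h n = d1 * y n - d2 * x n" for n
  have UV: "U n * V n = a\<^sup>2 * b\<^sup>2" for n
    using on[of n] unfolding U_def V_def ab by algebra
  have h: "h n = \<rho> * U n + \<sigma> * V n" for n
    unfolding h_def \<rho>_def \<sigma>_def U_def V_def using ab by (simp add: field_simps)
  have goal: "\<beta> * d1\<^sup>2 + k * d2\<^sup>2 = 4 * (a\<^sup>2 * b\<^sup>2) * (\<rho> * \<sigma>)"
    unfolding \<rho>_def \<sigma>_def ab(3,4) using ab(1,2) by (simp add: field_simps power2_eq_square)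
  have inf': "filterlim (\<lambda>n. s * (U n)\<^sup>2 + t * (V n)\<^sup>2) at_top sequentially" if "s > 0" "t > 0" for s t
  proof -
    \<comment> \<open>The factor 2 comes from \<open>U\<^sup>2 + V\<^sup>2 = 2 * (b\<^sup>2 *
      x\<^sup>2 + a\<^sup>2 * y\<^sup>2)\<close>.\<close>
    define \<mu> where "\<mu> = 2 * min s t * min (a\<^sup>2) (b\<^sup>2)"
    have "\<mu> > 0" unfolding \<mu>_def using that ab by auto
    then have "filterlim (\<lambda>n. \<mu> * ((x n)\<^sup>2 + (y n)\<^sup>2)) at_top sequentially"
      using inf by (rule filterlim_tendsto_pos_mult_at_top[OF tendsto_const])
    moreover have "\<mu> * ((x n)\<^sup>2 + (y n)\<^sup>2) \<le> s * (U n)\<^sup>2 + t * (V n)\<^sup>2" for n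
    proof -
      have "min (a\<^sup>2) (b\<^sup>2) * ((x n)\<^sup>2 + (y n)\<^sup>2) \<le> b\<^sup>2 * (x n)\<^sup>2 + a\<^sup>2 * (y n)\<^sup>2"
        unfolding distrib_left by (intro add_mono mult_right_mono) auto
      also have "2 * \<dots> = (U n)\<^sup>2 + (V n)\<^sup>2" unfolding U_def V_def by algebra
      finally have "min s t * (2 * (min (a\<^sup>2) (b\<^sup>2) * ((x n)\<^sup>2 + (y n)\<^sup>2))) \<le> min s t * ((U n)\<^sup>2 + (V n)\<^sup>2)"
        using that by (intro mult_left_mono) auto
      also have "\<dots> \<le> s * (U n)\<^sup>2 + t * (V n)\<^sup>2"
        unfolding distrib_left by (intro add_mono mult_right_mono) auto
      finally show ?thesis unfolding \<mu>_def by (simp add: mult_ac)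
    qed
    ultimately show ?thesis by (intro filterlim_at_top_mono[where g = "\<lambda>n. s * (U n)\<^sup>2 + t * (V n)\<^sup>2"]) auto
  qed
  have nlim: False if "s > 0" "t > 0" "(\<lambda>n. s * (U n)\<^sup>2 + t * (V n)\<^sup>2) \<longlonglongrightarrow> l" for s t l
    using not_tendsto_and_filterlim_at_infinity[OF _ that(3) filterlim_at_top_imp_at_infinity[OF inf'[OF that(1,2)]]] by simp
  have hlim: "h \<longlonglongrightarrow> p" using lim unfolding h_def .
  have "\<rho> \<noteq> 0 \<or> \<sigma> \<noteq> 0"
  proof (rule ccontr)
    assume "\<not> ?thesis"
    then have "b * d1 + a * d2 = 0" "b * d1 - a * d2 = 0" unfolding \<rho>_def \<sigma>_def using ab by auto
    then have "b * d1 = 0" "a * d2 = 0" by linarith+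
    then show False using ab d by simp
  qed
  then consider "\<rho> \<noteq> 0" "\<sigma> \<noteq> 0" | "\<rho> \<noteq> 0" "\<sigma> = 0" | "\<rho> = 0" "\<sigma> \<noteq> 0" by blast
  then show ?thesis
  proof cases
    case 1
    have "(\<lambda>n. (h n)\<^sup>2 - 2 * \<rho> * \<sigma> * (a\<^sup>2 * b\<^sup>2)) \<longlonglongrightarrow> p\<^sup>2 - 2 * \<rho> * \<sigma> * (a\<^sup>2 * b\<^sup>2)"
      by (intro tendsto_intros hlim)
    moreover have "(h n)\<^sup>2 - 2 * \<rho> * \<sigma> * (a\<^sup>2 * b\<^sup>2) = \<rho>\<^sup>2 * (U n)\<^sup>2 + \<sigma>\<^sup>2 * (V n)\<^sup>2" for n
      unfolding h UV[of n, symmetric] by algebra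
    ultimately show ?thesis using nlim[of "\<rho>\<^sup>2" "\<sigma>\<^sup>2"] 1 by auto
  next
    case 2
    have "p = 0"
    proof (rule ccontr)
      assume p: "p \<noteq> 0"
      have hz: "h n = \<rho> * U n" "h n \<noteq> 0" for n using h[of n] UV[of n] 2 ab by auto
      have "(\<lambda>n. (h n / \<rho>)\<^sup>2 + (\<rho> * (a\<^sup>2 * b\<^sup>2) / h n)\<^sup>2) \<longlonglongrightarrow> (p / \<rho>)\<^sup>2 + (\<rho> * (a\<^sup>2 * b\<^sup>2) / p)\<^sup>2"
        using p 2 by (intro tendsto_intros hlim) auto
      moreover have "(h n / \<rho>)\<^sup>2 + (\<rho> * (a\<^sup>2 * b\<^sup>2) / h n)\<^sup>2 = 1 * (U n)\<^sup>2 + 1 * (V n)\<^sup>2" for n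
      proof -
        have "h n / \<rho> = U n" using hz[of n] 2 by simp
        moreover have "\<rho> * (a\<^sup>2 * b\<^sup>2) / h n = V n" using hz[of n] 2 unfolding UV[of n, symmetric] by auto
        ultimately show ?thesis by simp
      qed
      ultimately show False using nlim[of 1 1] by auto
    qed
    then show ?thesis unfolding goal using 2 by simp
  next
    case 3
    have "p = 0"
    proof (rule ccontr)
      assume p: "p \<noteq> 0"
      have hz: "h n = \<sigma> * V n" "h n \<noteq> 0" for n using h[of n] UV[of n] 3 ab by auto
      have "(\<lambda>n. (h n / \<sigma>)\<^sup>2 + (\<sigma> * (a\<^sup>2 * b\<^sup>2) / h n)\<^sup>2) \<longlonglongrightarrow> (p / \<sigma>)\<^sup>2 + (\<sigma> * (a\<^sup>2 * b\<^sup>2) / p)\<^sup>2"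
        using p 3 by (intro tendsto_intros hlim) auto
      moreover have "(h n / \<sigma>)\<^sup>2 + (\<sigma> * (a\<^sup>2 * b\<^sup>2) / h n)\<^sup>2 = 1 * (U n)\<^sup>2 + 1 * (V n)\<^sup>2" for n
      proof -
        have "h n / \<sigma> = V n" using hz[of n] 3 by simp
        moreover have "\<sigma> * (a\<^sup>2 * b\<^sup>2) / h n = U n" using hz[of n] 3 unfolding UV[of n, symmetric] by auto
        ultimately show ?thesis by simp
      qed
      ultimately show False using nlim[of 1 1] by auto
    qed
    then show ?thesis unfolding goal using 3 by simp
  qed
qed

text \<open>Lagrange's identity for the bilinear form with weights \<open>\<beta>\<close> and
  \<open>k\<close>, for which a tangent vector is orthogonal to the radius.\<close>

lemma tangent_moment:
  fixes x y :: real
  assumes k: "k \<noteq> 0" "\<beta> \<noteq> 0" and "\<beta> * x\<^sup>2 + k * y\<^sup>2 = k * \<beta>" "\<beta> * x * v1 + k * y * v2 = 0"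
  shows "(v1 * y - v2 * x)\<^sup>2 = \<beta> * v1\<^sup>2 + k * v2\<^sup>2"
proof -
  have "k * \<beta> * (v1 * y - v2 * x)\<^sup>2 = k * \<beta> * (\<beta> * v1\<^sup>2 + k * v2\<^sup>2)"
  proof -
    have "(\<beta> * x * v1 + k * y * v2)\<^sup>2 + k * \<beta> * (v1 * y - v2 * x)\<^sup>2 = (\<beta> * x\<^sup>2 + k * y\<^sup>2) * (\<beta> * v1\<^sup>2 + k * v2\<^sup>2)"
      by algebra
    then show ?thesis by (simp only: assms(3,4) power_zero_numeral add_0_left)
  qed
  then show ?thesis using k by simp
qed

text \<open>Joachimsthal's integral: the chord's midpoint is conjugate to its direction, so the
  components at the ends are opposite; \<open>l > 0\<close> fixes the sign and Lagrange's identity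
  the square. The value depends on the caustic alone, so two trajectories with one caustic share
  it.\<close>

lemma chord_normal_component:
  fixes x y :: real
  assumes AB: "A > 0" "B > 0" and X: "B * x\<^sup>2 + A * y\<^sup>2 = A * B" and Y: "B * x'\<^sup>2 + A * y'\<^sup>2 = A * B"
    and l: "l > 0" "x' = x + l * d1" "y' = y + l * d2" and d: "d1\<^sup>2 + d2\<^sup>2 = 1"
    and p: "(d1 * y - d2 * x)\<^sup>2 = k - (A - B) * d1\<^sup>2"
  shows "d1 * (x / A) + d2 * (y / B) = - sqrt ((A - k) / (A * B))"
    and "d1 * (x' / A) + d2 * (y' / B) = sqrt ((A - k) / (A * B))"
proof -
  define q where "q = d1\<^sup>2 / A + d2\<^sup>2 / B"
  have "d1\<^sup>2 > 0 \<or> d2\<^sup>2 > 0" using d by auto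
  then have "q > 0" unfolding q_def using AB by (smt (verit) divide_pos_pos zero_le_power2 divide_nonneg_pos)
  have q: "A * B * q = B * d1\<^sup>2 + A * d2\<^sup>2" unfolding q_def using AB by (simp add: field_simps)
  have N: "A * B * (d1 * (x / A) + d2 * (y / B)) = B * d1 * x + A * d2 * y" "A * B * (d1 * (x' / A) + d2 * (y' / B)) = B * d1 * x' + A * d2 * y'"
    using AB by (simp_all add: field_simps)
  have "l * (2 * (B * d1 * x + A * d2 * y) + l * (A * B * q)) = 0"
    using X Y unfolding l q by algebra
  then have 1: "2 * (B * d1 * x + A * d2 * y) + l * (A * B * q) = 0" using l by simp
  have 2: "B * d1 * x' + A * d2 * y' = B * d1 * x + A * d2 * y + l * (A * B * q)"
    unfolding l q by algebra
  have 3: "B * d1 * x' + A * d2 * y' = l * (A * B * q) / 2" "B * d1 * x + A * d2 * y = - (l * (A * B * q) / 2)"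
  proof -
    have "u' = w / 2 \<and> u = - (w / 2)" if "2 * u + w = 0" "u' = u + w" for u u' w :: real
      using that by linarith
    from this[OF 1 2] show "B * d1 * x' + A * d2 * y' = l * (A * B * q) / 2" "B * d1 * x + A * d2 * y = - (l * (A * B * q) / 2)"
      by auto
  qed
  have pos: "d1 * (x' / A) + d2 * (y' / B) \<ge> 0"
  proof -
    have "A * B * (d1 * (x' / A) + d2 * (y' / B)) \<ge> 0" unfolding N 3 using AB l \<open>q > 0\<close> by simp
    then show ?thesis using mult_pos_pos[OF AB] by (metis zero_le_mult_iff not_less)
  qed
  have "(d1 * y' - d2 * x')\<^sup>2 = k - (A - B) * d1\<^sup>2" using p unfolding l by algebra
  then have "(B * d1 * x' + A * d2 * y')\<^sup>2 = A * B * (A - k)"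
  proof -
    have "(B * d1 * x' + A * d2 * y')\<^sup>2 + A * B * (d1 * y' - d2 * x')\<^sup>2 = (B * x'\<^sup>2 + A * y'\<^sup>2) * (B * d1\<^sup>2 + A * d2\<^sup>2)"
      by algebra
    moreover have "B * d1\<^sup>2 + A * d2\<^sup>2 = A - (A - B) * d1\<^sup>2" using d by algebra
    ultimately have "(B * d1 * x' + A * d2 * y')\<^sup>2 + A * B * (k - (A - B) * d1\<^sup>2) = A * B * (A - (A - B) * d1\<^sup>2)"
      by (simp only: Y \<open>(d1 * y' - d2 * x')\<^sup>2 = k - (A - B) * d1\<^sup>2\<close>)
    then show ?thesis by (simp add: algebra_simps)
  qed
  then have "(A * B) * (A * B * (d1 * (x' / A) + d2 * (y' / B))\<^sup>2) = (A * B) * (A - k)"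
    unfolding N(2)[symmetric] by algebra
  then have "A * B * (d1 * (x' / A) + d2 * (y' / B))\<^sup>2 = A - k" using AB by simp
  then have "(d1 * (x' / A) + d2 * (y' / B))\<^sup>2 = (A - k) / (A * B)" using AB by (simp add: field_simps)
  then show 4: "d1 * (x' / A) + d2 * (y' / B) = sqrt ((A - k) / (A * B))"
    using pos by (simp add: real_sqrt_unique)
  have *: "A * B * (d1 * (x / A) + d2 * (y / B)) = A * B * (- (d1 * (x' / A) + d2 * (y' / B)))"
    unfolding mult_minus_right N 3 by simp
  have "A * B \<noteq> 0" using AB by simp
  from mult_left_cancel[OF this, THEN iffD1, OF *]
  show "d1 * (x / A) + d2 * (y / B) = - sqrt ((A - k) / (A * B))" unfolding 4 .
qed

text \<open>Eliminating \<open>x\<close> by the moment leaves one quadratic equation for the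
  ordinates of both ends. By Vieta their product has the sign of
  \<open>p\<^sup>2 - A * d2\<^sup>2\<close>, which is negative for a hyperbolic caustic.\<close>

lemma chord_crosses_axis:
  fixes x y :: real
  assumes AB: "B > 0" "A > B" and X: "B * x\<^sup>2 + A * y\<^sup>2 = A * B" and Y: "B * x'\<^sup>2 + A * y'\<^sup>2 = A * B"
    and l: "l > 0" "x' = x + l * d1" "y' = y + l * d2" and d: "d1\<^sup>2 + d2\<^sup>2 = 1"
    and p: "(d1 * y - d2 * x)\<^sup>2 = k - (A - B) * d1\<^sup>2" and k: "k < A - B"
  shows "y * y' < 0"
proof -
  define p where "p = d1 * y - d2 * x"
  have p': "p = d1 * y' - d2 * x'" unfolding p_def l by algebra
  have p2: "p\<^sup>2 = (k - (A - B)) + (A - B) * d2\<^sup>2" unfolding p_def using p d by algebra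
  have "d2 \<noteq> 0" using p2 k zero_le_power2[of p] by auto
  have q: "B * d1\<^sup>2 + A * d2\<^sup>2 > 0" using AB \<open>d2 \<noteq> 0\<close> by (simp add: add_nonneg_pos)
  have "p\<^sup>2 < A * d2\<^sup>2"
  proof -
    have "A * d2\<^sup>2 - p\<^sup>2 = (A - B - k) + B * d2\<^sup>2" using p2 by algebra
    moreover have "B * d2\<^sup>2 \<ge> 0" using AB by simp
    ultimately show ?thesis using k by linarith
  qed
  have 1: "(B * d1\<^sup>2 + A * d2\<^sup>2) * y\<^sup>2 - 2 * B * d1 * p * y = A * B * d2\<^sup>2 - B * p\<^sup>2"
    using X unfolding p_def by algebra
  have 2: "(B * d1\<^sup>2 + A * d2\<^sup>2) * y'\<^sup>2 - 2 * B * d1 * p * y' = A * B * d2\<^sup>2 - B * p\<^sup>2"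
    using Y unfolding p' by algebra
  have "(y' - y) * ((B * d1\<^sup>2 + A * d2\<^sup>2) * (y + y') - 2 * B * d1 * p) = 0"
    using 1 2 by algebra
  moreover have "y' - y \<noteq> 0" using l \<open>d2 \<noteq> 0\<close> by simp
  ultimately have "(B * d1\<^sup>2 + A * d2\<^sup>2) * (y + y') = 2 * B * d1 * p" by simp
  then have "(B * d1\<^sup>2 + A * d2\<^sup>2) * (y * y') = B * (p\<^sup>2 - A * d2\<^sup>2)" using 1 by algebra
  also have "\<dots> < 0" using AB \<open>p\<^sup>2 < A * d2\<^sup>2\<close> by (simp add: mult_pos_neg)
  finally show ?thesis using q by (simp add: mult_less_0_iff)
qed

section \<open>Focal coordinates and the confocal family\<close>

text \<open>\<open>c\<close> is half the focal distance. With \<open>c = 0\<close> the unit vector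
  \<open>u\<close> is arbitrary, so circles are treated in the same frame.\<close>

locale focal_frame =
  fixes F1 F2 u :: "real^2" and c :: real
  assumes u: "(u $ 1)\<^sup>2 + (u $ 2)\<^sup>2 = 1" and foci: "F2 - F1 = (2 * c) *\<^sub>R u" and c: "c \<ge> 0"
begin

text \<open>\<open>xc\<close> and \<open>yc\<close> are for vectors; \<open>px\<close> and
  \<open>py\<close> below are for points and are measured from the centre.\<close>

definition xc :: "real^2 \<Rightarrow> real" where "xc v = u $ 1 * v $ 1 + u $ 2 * v $ 2"
definition yc :: "real^2 \<Rightarrow> real" where "yc v = u $ 1 * v $ 2 - u $ 2 * v $ 1"
definition of_coords :: "real \<Rightarrow> real \<Rightarrow> real^2" where "of_coords a b = a *\<^sub>R u + b *\<^sub>R vector [- u $ 2, u $ 1]"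
definition px :: "real^2 \<Rightarrow> real" where "px X = xc (X - midpoint F1 F2)"
definition py :: "real^2 \<Rightarrow> real" where "py X = yc (X - midpoint F1 F2)"
definition point :: "real \<Rightarrow> real \<Rightarrow> real^2" where "point a b = midpoint F1 F2 + of_coords a b"

lemma coord_linear [simp]:
  "xc (v + w) = xc v + xc w" "yc (v + w) = yc v + yc w"
  "xc (v - w) = xc v - xc w" "yc (v - w) = yc v - yc w"
  "xc (- v) = - xc v" "yc (- v) = - yc v"
  "xc (r *\<^sub>R v) = r * xc v" "yc (r *\<^sub>R v) = r * yc v"
  by (simp_all add: xc_def yc_def algebra_simps)

lemma bounded_linear_coord: "bounded_linear xc" "bounded_linear yc"
proof -
  have "xc = (\<lambda>v. u \<bullet> v)" by (auto simp: xc_def inner_vec_def sum_2)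
  then show "bounded_linear xc" by (simp add: bounded_linear_inner_right)
  have "yc = (\<lambda>v. vector [- u $ 2, u $ 1] \<bullet> v)" by (auto simp: yc_def inner_vec_def sum_2)
  then show "bounded_linear yc" by (simp add: bounded_linear_inner_right)
qed

lemma coord_of_coords [simp]: "xc (of_coords a b) = a" "yc (of_coords a b) = b"
proof -
  have "xc (of_coords a b) = a * ((u $ 1)\<^sup>2 + (u $ 2)\<^sup>2)" "yc (of_coords a b) = b * ((u $ 1)\<^sup>2 + (u $ 2)\<^sup>2)"
    unfolding xc_def yc_def of_coords_def by (simp_all add: power2_eq_square algebra_simps)
  then show "xc (of_coords a b) = a" "yc (of_coords a b) = b" using u by simp_all
qed

lemma of_coords_coord [simp]: "of_coords (xc v) (yc v) = v"
proof -
  have "v $ i * ((u $ 1)\<^sup>2 + (u $ 2)\<^sup>2) = v $ i" for i using u by simp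
  moreover have "of_coords (xc v) (yc v) $ i = v $ i * ((u $ 1)\<^sup>2 + (u $ 2)\<^sup>2)" for i
    using exhaust_2[of i] unfolding of_coords_def xc_def yc_def by (auto simp: power2_eq_square algebra_simps)
  ultimately show ?thesis by (simp add: vec_eq_iff)
qed

lemma coord_eqI: "xc v = xc w \<Longrightarrow> yc v = yc w \<Longrightarrow> v = w"
  by (metis of_coords_coord)

lemma inner_coord: "v \<bullet> w = xc v * xc w + yc v * yc w"
proof -
  have "xc v * xc w + yc v * yc w = (v $ 1 * w $ 1 + v $ 2 * w $ 2) * ((u $ 1)\<^sup>2 + (u $ 2)\<^sup>2)"
    unfolding xc_def yc_def by algebra
  then show ?thesis using u by (simp add: inner_vec_def sum_2)
qed

lemma det2_coord: "det2 v w = xc v * yc w - yc v * xc w"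
proof -
  have "xc v * yc w - yc v * xc w = det2 v w * ((u $ 1)\<^sup>2 + (u $ 2)\<^sup>2)"
    unfolding xc_def yc_def det2_def by algebra
  then show ?thesis using u by simp
qed

lemma norm_coord: "(norm v)\<^sup>2 = (xc v)\<^sup>2 + (yc v)\<^sup>2"
  unfolding power2_norm_eq_inner inner_coord by (simp add: power2_eq_square)

lemma coord_u [simp]: "xc u = 1" "yc u = 0"
  using u by (auto simp: xc_def yc_def power2_eq_square)

lemma coord_foci: "px F1 = - c" "py F1 = 0" "px F2 = c" "py F2 = 0"
proof -
  have "F1 - midpoint F1 F2 = (- c) *\<^sub>R u" "F2 - midpoint F1 F2 = c *\<^sub>R u"
    using foci by (simp_all add: midpoint_def algebra_simps vec_eq_iff)
  then show "px F1 = - c" "py F1 = 0" "px F2 = c" "py F2 = 0"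
    unfolding px_def py_def by simp_all
qed

lemma coord_point [simp]: "px (point a b) = a" "py (point a b) = b"
  by (simp_all add: px_def py_def point_def flip: coord_linear(3,4))

lemma point_coord [simp]: "point (px X) (py X) = X"
  by (simp add: point_def px_def py_def del: coord_linear)

lemma coord_add [simp]: "px (X + v) = px X + xc v" "py (X + v) = py X + yc v"
  by (simp_all add: px_def py_def)

lemma coord_diff: "xc (X - Y) = px X - px Y" "yc (X - Y) = py X - py Y"
  by (simp_all add: px_def py_def)

lemma dist_coord: "(dist X Y)\<^sup>2 = (px X - px Y)\<^sup>2 + (py X - py Y)\<^sup>2"
  unfolding dist_norm norm_coord coord_diff ..

lemma dist_foci: "dist F1 F2 = 2 * c"
proof -
  have "(dist F1 F2)\<^sup>2 = (2 * c)\<^sup>2" unfolding dist_coord coord_foci by simp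
  then show ?thesis by (rule power2_eq_imp_eq) (simp_all add: c)
qed

text \<open>At \<open>k = c\<^sup>2\<close> and \<open>k = 0\<close> this is the long and the short axis if \<open>c > 0\<close>, but the whole plane
  for \<open>k = c = 0\<close>.\<close>

definition conic :: "real \<Rightarrow> (real^2) set" where
  "conic k = {X. (k - c\<^sup>2) * (px X)\<^sup>2 + k * (py X)\<^sup>2 = k * (k - c\<^sup>2)}"

text \<open>With \<open>r1\<close>, \<open>r2\<close> the focal distances,
  \<open>(r1 + r2)\<^sup>2 - (2 * \<alpha>)\<^sup>2\<close> times
  \<open>(r1 - r2)\<^sup>2 - (2 * \<alpha>)\<^sup>2\<close> is a constant multiple of the conic
  equation. The triangle inequality later selects one factor.\<close>

lemma conic_dist:
  assumes "\<alpha> > 0"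
  shows "X \<in> conic (\<alpha>\<^sup>2) \<longleftrightarrow> dist X F1 + dist X F2 = 2 * \<alpha> \<or> \<bar>dist X F1 - dist X F2\<bar> = 2 * \<alpha>"
proof -
  define r1 r2 x y where "r1 = dist X F1" and "r2 = dist X F2" and "x = px X" and "y = py X"
  have r: "r1\<^sup>2 = (x + c)\<^sup>2 + y\<^sup>2" "r2\<^sup>2 = (x - c)\<^sup>2 + y\<^sup>2"
    unfolding r1_def r2_def x_def y_def dist_coord coord_foci by auto
  have "((r1 + r2)\<^sup>2 - (2 * \<alpha>)\<^sup>2) * ((r1 - r2)\<^sup>2 - (2 * \<alpha>)\<^sup>2)
      = 16 * (\<alpha>\<^sup>2 * (\<alpha>\<^sup>2 - c\<^sup>2) - ((\<alpha>\<^sup>2 - c\<^sup>2) * x\<^sup>2 + \<alpha>\<^sup>2 * y\<^sup>2))"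
    using r by algebra
  moreover have "X \<in> conic (\<alpha>\<^sup>2) \<longleftrightarrow> 16 * (\<alpha>\<^sup>2 * (\<alpha>\<^sup>2 - c\<^sup>2) - ((\<alpha>\<^sup>2 - c\<^sup>2) * x\<^sup>2 + \<alpha>\<^sup>2 * y\<^sup>2)) = 0"
    unfolding conic_def x_def y_def by auto
  ultimately have "X \<in> conic (\<alpha>\<^sup>2) \<longleftrightarrow> (r1 + r2)\<^sup>2 - (2 * \<alpha>)\<^sup>2 = 0 \<or> (r1 - r2)\<^sup>2 - (2 * \<alpha>)\<^sup>2 = 0"
    by (metis mult_eq_0_iff)
  then have "X \<in> conic (\<alpha>\<^sup>2) \<longleftrightarrow> (r1 + r2)\<^sup>2 = (2 * \<alpha>)\<^sup>2 \<or> (r1 - r2)\<^sup>2 = (2 * \<alpha>)\<^sup>2"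
    by (simp only: right_minus_eq)
  also have "(r1 + r2)\<^sup>2 = (2 * \<alpha>)\<^sup>2 \<longleftrightarrow> r1 + r2 = 2 * \<alpha>"
    using assms unfolding r1_def r2_def by (intro power2_eq_iff_nonneg) auto
  also have "(r1 - r2)\<^sup>2 = (2 * \<alpha>)\<^sup>2 \<longleftrightarrow> \<bar>r1 - r2\<bar> = 2 * \<alpha>"
    unfolding power2_abs[of "r1 - r2", symmetric] using assms by (intro power2_eq_iff_nonneg) auto
  finally show ?thesis unfolding r1_def r2_def .
qed

lemma dist_diff_le: "\<bar>dist X F1 - dist X F2\<bar> \<le> 2 * c" and dist_sum_ge: "2 * c \<le> dist X F1 + dist X F2"
  using dist_triangle[of X F1 F2] dist_triangle[of X F2 F1] dist_triangle[of F1 F2 X] dist_foci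
  by (auto simp: dist_commute abs_le_iff)

lemma ellipse_conic: "k > c\<^sup>2 \<Longrightarrow> conic k = {X. dist X F1 + dist X F2 = 2 * sqrt k}"
proof -
  assume k: "k > c\<^sup>2"
  then have "sqrt k > c" using c by (simp add: real_less_rsqrt)
  moreover have "k > 0" using k zero_le_power2[of c] by linarith
  ultimately show ?thesis
    using conic_dist[of "sqrt k"] dist_diff_le c by (auto intro!: set_eqI simp: not_le[symmetric]) (smt (verit))+
qed

lemma hyperbola_conic: "0 < k \<Longrightarrow> k < c\<^sup>2 \<Longrightarrow> conic k = {X. \<bar>dist X F1 - dist X F2\<bar> = 2 * sqrt k}"
proof -
  assume k: "0 < k" "k < c\<^sup>2"
  then have "sqrt k < c" using c by (simp add: real_less_lsqrt)
  then show ?thesis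
    using conic_dist[of "sqrt k"] dist_sum_ge c k by (auto intro!: set_eqI) (smt (verit))+
qed

lemma ellipse_iff: "ellipse_with_foci F1 F2 S \<longleftrightarrow> (\<exists>k. k > c\<^sup>2 \<and> S = conic k)"
proof
  assume "ellipse_with_foci F1 F2 S"
  then obtain s where s: "2 * c < s" "S = {X. dist X F1 + dist X F2 = s}"
    unfolding ellipse_with_foci_def dist_foci by auto
  have "(s / 2)\<^sup>2 > c\<^sup>2" using s c by (intro power_strict_mono) auto
  moreover have "S = conic ((s / 2)\<^sup>2)" unfolding ellipse_conic[OF calculation] s(2) using s(1) c by simp
  ultimately show "\<exists>k. k > c\<^sup>2 \<and> S = conic k" by blast
next
  assume "\<exists>k. k > c\<^sup>2 \<and> S = conic k"
  then obtain k where k: "k > c\<^sup>2" "S = conic k" by blast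
  have "2 * c < 2 * sqrt k" using k c by (simp add: real_less_rsqrt)
  then show "ellipse_with_foci F1 F2 S" unfolding ellipse_with_foci_def dist_foci k(2) ellipse_conic[OF k(1)] by blast
qed

lemma hyperbola_iff: "hyperbola_with_foci F1 F2 S \<longleftrightarrow> (\<exists>k. 0 < k \<and> k < c\<^sup>2 \<and> S = conic k)"
proof
  assume "hyperbola_with_foci F1 F2 S"
  then obtain s where s: "0 < s" "s < 2 * c" "S = {X. \<bar>dist X F1 - dist X F2\<bar> = s}"
    unfolding hyperbola_with_foci_def dist_foci by auto
  have *: "0 < (s / 2)\<^sup>2" "(s / 2)\<^sup>2 < c\<^sup>2" using s c by (auto intro!: power_strict_mono simp del: power_divide)
  moreover have "S = conic ((s / 2)\<^sup>2)" unfolding hyperbola_conic[OF *] s(3) using s(1) by simp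
  ultimately show "\<exists>k. 0 < k \<and> k < c\<^sup>2 \<and> S = conic k" by blast
next
  assume "\<exists>k. 0 < k \<and> k < c\<^sup>2 \<and> S = conic k"
  then obtain k where k: "0 < k" "k < c\<^sup>2" "S = conic k" by blast
  have "2 * sqrt k < 2 * c" using k c by (simp add: real_less_lsqrt)
  moreover have "0 < 2 * sqrt k" using k by simp
  ultimately show "hyperbola_with_foci F1 F2 S" unfolding hyperbola_with_foci_def dist_foci k(3) hyperbola_conic[OF k(1,2)] by blast
qed

lemma not_ellipse_and_hyperbola: "\<not> (ellipse_with_foci F1 F2 S \<and> hyperbola_with_foci F1 F2 S)"
proof
  assume *: "ellipse_with_foci F1 F2 S \<and> hyperbola_with_foci F1 F2 S"
  obtain k where k: "k > c\<^sup>2" "S = conic k" using * ellipse_iff by blast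
  obtain l where l: "0 < l" "l < c\<^sup>2" "S = conic l" using * hyperbola_iff by blast
  \<comment> \<open>The witness is a vertex of the hyperbola; on \<open>conic k\<close> it would
    force \<open>k = l\<close>.\<close>
  have "point (sqrt l) 0 \<in> S" unfolding l(3) conic_def using l by (simp add: mult.commute)
  then have "(k - c\<^sup>2) * l = (k - c\<^sup>2) * k" unfolding k(2) conic_def using l by (simp add: mult.commute)
  then show False using k l by simp
qed

lemma central_line:
  assumes ab: "a \<noteq> 0 \<or> b \<noteq> 0"
  shows "{X. a * px X + b * py X = 0} = range (\<lambda>t. midpoint F1 F2 + t *\<^sub>R of_coords (- b) a)" (is "?A = ?B")
proof (intro equalityI subsetI)
  fix X assume "X \<in> ?A"
  then have X: "a * px X + b * py X = 0" by simp
  have s: "a\<^sup>2 + b\<^sup>2 \<noteq> 0" using ab by (simp add: sum_power2_eq_zero_iff)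
  define t where "t = (a * py X - b * px X) / (a\<^sup>2 + b\<^sup>2)"
  have "(a\<^sup>2 + b\<^sup>2) * px X = (a * py X - b * px X) * (- b)" "(a\<^sup>2 + b\<^sup>2) * py X = (a * py X - b * px X) * a"
    using X by algebra+
  then have "px X = t * (- b)" "py X = t * a" unfolding t_def using s by (simp_all add: field_simps)
  then have "X - midpoint F1 F2 = t *\<^sub>R of_coords (- b) a" unfolding px_def py_def by (intro coord_eqI) simp_all
  then have "X = midpoint F1 F2 + t *\<^sub>R of_coords (- b) a" by (simp add: algebra_simps)
  then show "X \<in> range (\<lambda>t. midpoint F1 F2 + t *\<^sub>R of_coords (- b) a)" by blast
next
  fix X assume "X \<in> ?B"
  then show "X \<in> ?A" by (auto simp: px_def py_def)
qed

lemma of_coords_eq_0: "of_coords a b = 0 \<longleftrightarrow> a = 0 \<and> b = 0"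
proof -
  have "of_coords 0 0 = 0" by (simp add: of_coords_def)
  then show ?thesis using coord_of_coords[of a b] coord_of_coords[of 0 0] by metis
qed

lemma coord_focal: "xc (F2 - F1) = 2 * c" "yc (F2 - F1) = 0"
  unfolding foci by simp_all

lemma long_axis_line: "long_axis F1 F2 {X. py X = 0}"
  unfolding long_axis_def using central_line[of 0 1]
  by (intro exI[of _ "of_coords (- 1) 0"]) (auto simp: of_coords_eq_0 det2_coord coord_focal simp del: coord_linear)

lemma short_axis_line: "short_axis F1 F2 {X. px X = 0}"
  unfolding short_axis_def using central_line[of 1 0]
  by (intro exI[of _ "of_coords 0 1"]) (auto simp: of_coords_eq_0 inner_coord coord_focal simp del: coord_linear)

lemma long_axis_circle: "c = 0 \<Longrightarrow> a \<noteq> 0 \<or> b \<noteq> 0 \<Longrightarrow> long_axis F1 F2 {X. a * px X + b * py X = 0}"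
  unfolding long_axis_def using central_line[of a b]
  by (intro exI[of _ "of_coords (- b) a"]) (auto simp: of_coords_eq_0 det2_coord coord_focal simp del: coord_linear)

lemma conic_ellipse: "k > c\<^sup>2 \<Longrightarrow> ellipse_with_foci F1 F2 (conic k)"
  unfolding ellipse_iff by blast

lemma conic_hyperbola: "0 \<le> k \<Longrightarrow> k < c\<^sup>2 \<Longrightarrow> hyperbola_with_foci F1 F2 (conic k) \<or> short_axis F1 F2 (conic k)"
proof (cases "k = 0")
  case True
  assume "k < c\<^sup>2"
  then have "conic k = {X. px X = 0}" using True unfolding conic_def by auto
  then show ?thesis using short_axis_line by simp
next
  case False
  assume "0 \<le> k" "k < c\<^sup>2"
  then show ?thesis using False hyperbola_iff by (metis order_le_less)
qed

lemma conic_long_axis: "c > 0 \<Longrightarrow> long_axis F1 F2 (conic (c\<^sup>2))"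
proof -
  assume "c > 0"
  then have "conic (c\<^sup>2) = {X. py X = 0}" unfolding conic_def by auto
  then show ?thesis using long_axis_line by simp
qed

section \<open>Tangents and asymptotes of the confocal conics\<close>

lemma tangent_vector_conic:
  assumes "tangent_vector (conic k) X v"
  shows "(k - c\<^sup>2) * px X * xc v + k * py X * yc v = 0"
proof -
  obtain \<gamma> where g: "\<gamma> 0 = X" "\<And>t. \<gamma> t \<in> conic k" "(\<gamma> has_vector_derivative v) (at 0)"
    using assms unfolding tangent_vector_def by blast
  have "((\<lambda>t. xc (\<gamma> t)) has_real_derivative xc v) (at 0)" "((\<lambda>t. yc (\<gamma> t)) has_real_derivative yc v) (at 0)"
    using bounded_linear_coord[THEN bounded_linear.has_vector_derivative, OF g(3)]
    by (simp_all add: has_real_derivative_iff_has_vector_derivative)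
  then have d: "((\<lambda>t. px (\<gamma> t)) has_real_derivative xc v) (at 0)" "((\<lambda>t. py (\<gamma> t)) has_real_derivative yc v) (at 0)"
    unfolding px_def py_def coord_linear by (auto intro!: derivative_eq_intros)
  have "((\<lambda>t. (k - c\<^sup>2) * (px (\<gamma> t))\<^sup>2 + k * (py (\<gamma> t))\<^sup>2) has_real_derivative
      2 * ((k - c\<^sup>2) * px X * xc v + k * py X * yc v)) (at 0)"
    by (rule derivative_eq_intros d refl | simp add: g(1) algebra_simps)+
  moreover have "(\<lambda>t. (k - c\<^sup>2) * (px (\<gamma> t))\<^sup>2 + k * (py (\<gamma> t))\<^sup>2) = (\<lambda>t. k * (k - c\<^sup>2))"
    using g(2) unfolding conic_def by auto
  ultimately have "2 * ((k - c\<^sup>2) * px X * xc v + k * py X * yc v) = 0"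
    using DERIV_const DERIV_unique by metis
  then show ?thesis by simp
qed

text \<open>The reflection law quantifies over tangent vectors, so a nonzero one has to be
  exhibited. The curve through \<open>X\<close> is the affine image of a rotation of the
  circle.\<close>

lemma tangent_vector_ellipse:
  assumes k: "k > c\<^sup>2" and X: "X \<in> conic k"
  shows "tangent_vector (conic k) X (of_coords (- (sqrt k / sqrt (k - c\<^sup>2) * py X)) (sqrt (k - c\<^sup>2) / sqrt k * px X))"
proof -
  define a b where "a = sqrt k" and "b = sqrt (k - c\<^sup>2)"
  have k0: "k > 0" using k zero_le_power2[of c] by linarith
  have ab: "a > 0" "b > 0" "a\<^sup>2 = k" "b\<^sup>2 = k - c\<^sup>2" using k k0 unfolding a_def b_def by auto
  define \<gamma> where "\<gamma> t = point (px X * cos t - a / b * py X * sin t) (py X * cos t + b / a * px X * sin t)" for t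
  have x: "px X * cos t - a / b * py X * sin t = (b * px X * cos t - a * py X * sin t) / b"
    and y: "py X * cos t + b / a * px X * sin t = (a * py X * cos t + b * px X * sin t) / a" for t
    using ab by (simp_all add: field_simps)
  have "\<gamma> t \<in> conic k" for t
  proof -
    have "(b * px X * cos t - a * py X * sin t)\<^sup>2 + (a * py X * cos t + b * px X * sin t)\<^sup>2
      = (b\<^sup>2 * (px X)\<^sup>2 + a\<^sup>2 * (py X)\<^sup>2) * ((sin t)\<^sup>2 + (cos t)\<^sup>2)" by algebra
    also have "\<dots> = a\<^sup>2 * b\<^sup>2" using X unfolding conic_def ab sin_cos_squared_add by simp
    finally show ?thesis
      unfolding \<gamma>_def conic_def mem_Collect_eq coord_point x y ab(4)[symmetric] 
      unfolding ab(3)[symmetric] using ab(1,2) by (simp add: power_divide)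
  qed
  moreover have "\<gamma> 0 = X" unfolding \<gamma>_def by simp
  moreover have "(\<gamma> has_vector_derivative of_coords (- (a / b * py X)) (b / a * px X)) (at 0)"
    unfolding \<gamma>_def point_def of_coords_def
    by (rule derivative_eq_intros refl | simp)+
  ultimately show ?thesis unfolding tangent_vector_def a_def b_def by blast
qed


lemma det2_le_norm:
  assumes "norm d = 1"
  shows "\<bar>det2 d w\<bar> \<le> norm w"
proof -
  have "(xc d)\<^sup>2 + (yc d)\<^sup>2 = 1" using norm_coord[of d] assms by simp
  then have "(norm w)\<^sup>2 = (det2 d w)\<^sup>2 + (d \<bullet> w)\<^sup>2"
    unfolding norm_coord det2_coord inner_coord by algebra
  then have "(det2 d w)\<^sup>2 \<le> (norm w)\<^sup>2" by simp
  then show ?thesis using abs_le_square_iff[of "det2 d w" "norm w"] by simp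
qed

lemma asymptote_conic:
  assumes k: "k > 0" "k \<noteq> c\<^sup>2" and d: "norm d = 1" and as: "asymptote (conic k) (range (\<lambda>t. P + t *\<^sub>R d))"
  shows "(xc d * py P - yc d * px P)\<^sup>2 = k - c\<^sup>2 * (xc d)\<^sup>2"
proof -
  define p where "p = xc d * py P - yc d * px P"
  define L where "L = range (\<lambda>t. P + t *\<^sub>R d)"
  obtain \<gamma> :: "nat \<Rightarrow> real^2" where g: "\<And>n. \<gamma> n \<in> conic k" "filterlim \<gamma> at_infinity sequentially" "(\<lambda>n. infdist (\<gamma> n) L) \<longlonglongrightarrow> 0"
    using as unfolding asymptote_def L_def by blast
  have norm_inf: "filterlim (\<lambda>n. norm (\<gamma> n)) at_top sequentially"
    using g(2) by (rule filterlim_at_infinity_imp_norm_at_top)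
  \<comment> \<open>An ellipse is bounded, whereas an asymptote comes with a sequence on the conic
    that escapes to infinity.\<close>
  have kc: "k < c\<^sup>2"
  proof (rule ccontr)
    assume "\<not> k < c\<^sup>2"
    then have "k > c\<^sup>2" using k by simp
    have "norm (\<gamma> n) \<le> norm F1 + 2 * sqrt k" for n
    proof -
      have "dist (\<gamma> n) F1 + dist (\<gamma> n) F2 = 2 * sqrt k"
        using g(1)[of n] ellipse_conic[OF \<open>k > c\<^sup>2\<close>] by auto
      then show ?thesis using norm_ge_zero[of "\<gamma> n - F2"] norm_triangle_ineq[of "\<gamma> n - F1" F1]
        unfolding dist_norm by (simp only: diff_add_cancel)
    qed
    moreover have "eventually (\<lambda>n. norm (\<gamma> n) > norm F1 + 2 * sqrt k) sequentially"
      using norm_inf unfolding filterlim_at_top_dense by blast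
    ultimately show False by (metis (no_types, lifting) eventually_happens not_less sequentially_bot)
  qed
  have "filterlim (\<lambda>n. - norm (midpoint F1 F2) + norm (\<gamma> n)) at_top sequentially"
    by (rule filterlim_tendsto_add_at_top[OF tendsto_const norm_inf]) 
  moreover have "- norm (midpoint F1 F2) + norm (\<gamma> n) \<le> norm (\<gamma> n - midpoint F1 F2)" for n
    using norm_triangle_ineq2[of "\<gamma> n" "midpoint F1 F2"] by simp
  ultimately have "filterlim (\<lambda>n. norm (\<gamma> n - midpoint F1 F2)) at_top sequentially"
    by (intro filterlim_at_top_mono[where g = "\<lambda>n. norm (\<gamma> n - midpoint F1 F2)"]) auto
  then have "filterlim (\<lambda>n. (norm (\<gamma> n - midpoint F1 F2))\<^sup>2) at_top sequentially"
    by (intro filterlim_pow_at_top) auto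
  then have inf: "filterlim (\<lambda>n. (px (\<gamma> n))\<^sup>2 + (py (\<gamma> n))\<^sup>2) at_top sequentially"
    unfolding norm_coord px_def py_def .
  \<comment> \<open>The left side is the distance from \<open>\<gamma> n\<close> to the line, so the
    moments of the points along \<open>d\<close> converge to that of the line.\<close>
  have "\<bar>xc d * py (\<gamma> n) - yc d * px (\<gamma> n) - p\<bar> \<le> infdist (\<gamma> n) L" for n
  proof -
    have "L \<noteq> {}" unfolding L_def by simp
    moreover have "\<bar>xc d * py (\<gamma> n) - yc d * px (\<gamma> n) - p\<bar> \<le> dist (\<gamma> n) Y" if Y: "Y \<in> L" for Y
    proof -
      obtain t where "Y = P + t *\<^sub>R d" using Y unfolding L_def by blast
      then have "xc d * py (\<gamma> n) - yc d * px (\<gamma> n) - p = det2 d (\<gamma> n - Y)"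
        unfolding det2_coord coord_diff p_def by (simp add: algebra_simps)
      then show ?thesis using det2_le_norm[OF d] unfolding dist_norm by metis
    qed
    ultimately show ?thesis unfolding infdist_def by (auto intro!: cINF_greatest)
  qed
  then have "(\<lambda>n. xc d * py (\<gamma> n) - yc d * px (\<gamma> n) - p) \<longlonglongrightarrow> 0"
    by (intro Lim_null_comparison[OF _ g(3)]) auto
  then have "(\<lambda>n. xc d * py (\<gamma> n) - yc d * px (\<gamma> n)) \<longlonglongrightarrow> p"
    using LIM_zero_iff by fastforce
  moreover have u: "(xc d)\<^sup>2 + (yc d)\<^sup>2 = 1" using norm_coord[of d] d by simp
  moreover have "(k - c\<^sup>2) * (px (\<gamma> n))\<^sup>2 + k * (py (\<gamma> n))\<^sup>2 = k * (k - c\<^sup>2)" for n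
    using g(1) unfolding conic_def by auto
  ultimately have "p\<^sup>2 = (k - c\<^sup>2) * (xc d)\<^sup>2 + k * (yc d)\<^sup>2"
    using hyperbola_asymptote_moment[OF k(1) _ _ inf] kc by auto
  then show ?thesis unfolding p_def using u by algebra
qed

lemma tangent_line_moment:
  assumes k: "k > 0" "k \<noteq> c\<^sup>2" and d: "norm d = 1" and t: "tangent_line (conic k) (range (\<lambda>t. P + t *\<^sub>R d))"
  shows "(xc d * py P - yc d * px P)\<^sup>2 = k - c\<^sup>2 * (xc d)\<^sup>2"
  using t unfolding tangent_line_def
proof
  assume "\<exists>X v. X \<in> conic k \<and> v \<noteq> 0 \<and> tangent_vector (conic k) X v \<and> range (\<lambda>t. P + t *\<^sub>R d) = range (\<lambda>t. X + t *\<^sub>R v)"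
  then obtain X v where X: "X \<in> conic k" and v: "tangent_vector (conic k) X v"
    and L: "range (\<lambda>t. P + t *\<^sub>R d) = range (\<lambda>t. X + t *\<^sub>R v)" by blast
  have "P \<in> range (\<lambda>t. P + t *\<^sub>R d)" by (rule range_eqI[of _ _ 0]) simp
  then obtain a where a: "P = X + a *\<^sub>R v" using L by auto
  have "P + d \<in> range (\<lambda>t. P + t *\<^sub>R d)" by (rule range_eqI[of _ _ 1]) simp
  then obtain b where b: "P + d = X + b *\<^sub>R v" using L by auto
  define s where "s = b - a"
  have ds: "d = s *\<^sub>R v" using a b unfolding s_def by (simp add: algebra_simps)
  have u: "(xc d)\<^sup>2 + (yc d)\<^sup>2 = 1" using norm_coord[of d] d by simp
  have "(xc v * py X - yc v * px X)\<^sup>2 = (k - c\<^sup>2) * (xc v)\<^sup>2 + k * (yc v)\<^sup>2"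
    using tangent_moment[of k "k - c\<^sup>2" "px X" "py X"] tangent_vector_conic[OF v] X k unfolding conic_def by auto
  moreover have "xc d * py P - yc d * px P = s * (xc v * py X - yc v * px X)"
    unfolding ds a by (simp add: algebra_simps)
  moreover have "xc d = s * xc v" "yc d = s * yc v" unfolding ds by simp_all
  ultimately show ?thesis using u by algebra
qed (use asymptote_conic[OF k d] in blast)

section \<open>From trajectories to billiard paths\<close>

definition dx :: "(int \<Rightarrow> real^2) \<Rightarrow> int \<Rightarrow> real" where "dx P m = xc (sgn (P (m + 1) - P m))"
definition dy :: "(int \<Rightarrow> real^2) \<Rightarrow> int \<Rightarrow> real" where "dy P m = yc (sgn (P (m + 1) - P m))"
definition mom :: "(int \<Rightarrow> real^2) \<Rightarrow> int \<Rightarrow> real" where "mom P m = dx P m * py (P m) - dy P m * px (P m)"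

lemma side_line_range: "side_line P m = range (\<lambda>t. P m + t *\<^sub>R sgn (P (m + 1) - P m))"
  unfolding side_line_def by (rule affine_hull_2_line)

lemma on_side_line: "X \<in> side_line P m \<Longrightarrow> dx P m * py X - dy P m * px X = mom P m"
  unfolding side_line_range mom_def dx_def dy_def by (auto simp: algebra_simps)

lemma next_vertex:
  assumes "P m \<noteq> P (m + 1)"
  obtains l where "l > 0" "px (P (m + 1)) = px (P m) + l * dx P m" "py (P (m + 1)) = py (P m) + l * dy P m"
proof
  show "norm (P (m + 1) - P m) > 0" using assms by simp
  have "P (m + 1) = P m + norm (P (m + 1) - P m) *\<^sub>R sgn (P (m + 1) - P m)"
    using assms by (simp add: sgn_div_norm)
  from arg_cong[OF this, of px] arg_cong[OF this, of py]
  show "px (P (m + 1)) = px (P m) + norm (P (m + 1) - P m) * dx P m"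
    "py (P (m + 1)) = py (P m) + norm (P (m + 1) - P m) * dy P m"
    unfolding dx_def dy_def coord_add by simp_all
qed

lemma unit_direction: "P m \<noteq> P (m + 1) \<Longrightarrow> (dx P m)\<^sup>2 + (dy P m)\<^sup>2 = 1"
  unfolding dx_def dy_def norm_coord[symmetric] by (simp add: norm_sgn)

text \<open>If the determinant vanished, the directions would be proportional and
  \<open>X + d\<close> would be a second common point.\<close>

lemma single_intersection:
  assumes ne: "P m \<noteq> P (m + 1)" "Q m \<noteq> Q (m + 1)" and X: "side_line P m \<inter> side_line Q m = {X}"
  shows "dx P m * dy Q m - dy P m * dx Q m \<noteq> 0"
proof
  assume det: "dx P m * dy Q m - dy P m * dx Q m = 0"
  define d e where "d = sgn (P (m + 1) - P m)" and "e = sgn (Q (m + 1) - Q m)"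
  define t where "t = dx P m * dx Q m + dy P m * dy Q m"
  have "dx P m = t * dx Q m" "dy P m = t * dy Q m"
    unfolding t_def using det unit_direction[OF ne(1)] unit_direction[OF ne(2)] by algebra+
  then have de: "d = t *\<^sub>R e" by (intro coord_eqI) (simp_all add: d_def e_def dx_def dy_def)
  obtain a b where a: "X = P m + a *\<^sub>R d" and b: "X = Q m + b *\<^sub>R e"
    using X unfolding side_line_range d_def e_def by blast
  have "X + d = P m + (a + 1) *\<^sub>R d" using a by (simp add: algebra_simps)
  moreover have "X + d = Q m + (b + t) *\<^sub>R e" using b de by (simp add: algebra_simps)
  ultimately have "X + d \<in> side_line P m \<inter> side_line Q m" unfolding side_line_range d_def e_def by blast
  then have "d = 0" using X by auto
  then show False using ne unfolding d_def by (simp add: sgn_zero_iff)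
qed

text \<open>Both unit vectors point away from the vertex, so the incoming one is opposite to the
  direction of motion; this accounts for the signs.\<close>

lemma reflection_law_ellipse:
  assumes A: "A > c\<^sup>2" and X: "X \<in> conic A" and r: "reflection_law (conic A) P X R"
  shows "xc (sgn (R - X)) * (px X / A) + yc (sgn (R - X)) * (py X / (A - c\<^sup>2))
       = xc (sgn (P - X)) * (px X / A) + yc (sgn (P - X)) * (py X / (A - c\<^sup>2))"
    and "xc (sgn (R - X)) * (py X / (A - c\<^sup>2)) - yc (sgn (R - X)) * (px X / A)
       = - (xc (sgn (P - X)) * (py X / (A - c\<^sup>2)) - yc (sgn (P - X)) * (px X / A))"
proof -
  have A0: "A > 0" "A - c\<^sup>2 > 0" using A zero_le_power2[of c] by linarith+
  define s t where "s = sgn (P - X)" and "t = sgn (R - X)"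
  have n: "normal_vector (conic A) X (of_coords (px X / A) (py X / (A - c\<^sup>2)))"
    unfolding normal_vector_def
  proof (intro allI impI)
    fix v assume v: "tangent_vector (conic A) X v"
    have "of_coords (px X / A) (py X / (A - c\<^sup>2)) \<bullet> v = ((A - c\<^sup>2) * px X * xc v + A * py X * yc v) / (A * (A - c\<^sup>2))"
      unfolding inner_coord coord_of_coords using A0 by (simp add: field_simps)
    then show "of_coords (px X / A) (py X / (A - c\<^sup>2)) \<bullet> v = 0" unfolding tangent_vector_conic[OF v] by simp
  qed
  then show "xc (sgn (R - X)) * (px X / A) + yc (sgn (R - X)) * (py X / (A - c\<^sup>2))
       = xc (sgn (P - X)) * (px X / A) + yc (sgn (P - X)) * (py X / (A - c\<^sup>2))"
    using r unfolding reflection_law_def inner_coord by fastforce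
  define a b where "a = sqrt A" and "b = sqrt (A - c\<^sup>2)"
  have ab: "a > 0" "b > 0" "A = a\<^sup>2" "A - c\<^sup>2 = b\<^sup>2" using A0 unfolding a_def b_def by auto
  have "s \<bullet> of_coords (- (a / b * py X)) (b / a * px X) = - (t \<bullet> of_coords (- (a / b * py X)) (b / a * px X))"
    using tangent_vector_ellipse[OF A X] r unfolding reflection_law_def s_def t_def a_def b_def by blast
  then have "- (xc s * (a / b * py X)) + yc s * (b / a * px X) = xc t * (a / b * py X) - yc t * (b / a * px X)"
    unfolding inner_coord by simp
  \<comment> \<open>The tangent vector of \<open>tangent_vector_ellipse\<close> is
    \<open>a * b\<close> times the normal turned by a right angle.\<close>
  moreover have "a / b * py X = a * b * (py X / (A - c\<^sup>2))" "b / a * px X = a * b * (px X / A)"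
  proof -
    have "a / b * py X = a * b * (py X / b\<^sup>2)" "b / a * px X = a * b * (px X / a\<^sup>2)"
      using ab(1,2) by (simp_all add: power2_eq_square)
    then show "a / b * py X = a * b * (py X / (A - c\<^sup>2))" "b / a * px X = a * b * (px X / A)"
      by (simp_all only: ab(3,4)[symmetric])
  qed
  ultimately have "a * b * (xc t * (py X / (A - c\<^sup>2)) - yc t * (px X / A)) = a * b * (- (xc s * (py X / (A - c\<^sup>2)) - yc s * (px X / A)))"
    by algebra
  then show "xc (sgn (R - X)) * (py X / (A - c\<^sup>2)) - yc (sgn (R - X)) * (px X / A)
       = - (xc (sgn (P - X)) * (py X / (A - c\<^sup>2)) - yc (sgn (P - X)) * (px X / A))"
    using ab(1,2) unfolding s_def t_def by (metis mult_left_cancel mult_pos_pos less_irrefl)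
qed


text \<open>Tangency to the caustic fixes the moments and, through the chord lemma, the normal
  components at both ends; the reflection law supplies the tangential components.\<close>

lemma billiard_path_trajectory:
  assumes A: "A > c\<^sup>2" and k: "k > 0" "k \<noteq> c\<^sup>2"
    and traj: "billiard_trajectory (conic A) P" and tangent: "\<And>m. tangent_line (conic k) (side_line P m)"
  shows "billiard_path A (A - c\<^sup>2) (sqrt ((A - k) / (A * (A - c\<^sup>2)))) (\<lambda>m. px (P m) / A) (\<lambda>m. py (P m) / (A - c\<^sup>2)) (dx P) (dy P)"
    and "(mom P m)\<^sup>2 = k - c\<^sup>2 * (dx P m)\<^sup>2"
proof -
  have A0: "A > 0" "A - c\<^sup>2 > 0" using A zero_le_power2[of c] by linarith+
  have on: "P m \<in> conic A" and ne: "P m \<noteq> P (m + 1)" and refl: "reflection_law (conic A) (P (m - 1)) (P m) (P (m + 1))" for m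
    using traj unfolding billiard_trajectory_def by auto
  have E: "(A - c\<^sup>2) * (px (P m))\<^sup>2 + A * (py (P m))\<^sup>2 = A * (A - c\<^sup>2)" for m
    using on[of m] unfolding conic_def by simp
  have mom: "(mom P m)\<^sup>2 = k - c\<^sup>2 * (dx P m)\<^sup>2" for m
  proof -
    have "norm (sgn (P (m + 1) - P m)) = 1" using ne[of m] by (simp add: norm_sgn)
    from tangent_line_moment[OF k this tangent[of m, unfolded side_line_range]]
    show ?thesis unfolding mom_def dx_def dy_def .
  qed
  then show "(mom P m)\<^sup>2 = k - c\<^sup>2 * (dx P m)\<^sup>2" .
  show "billiard_path A (A - c\<^sup>2) (sqrt ((A - k) / (A * (A - c\<^sup>2)))) (\<lambda>m. px (P m) / A) (\<lambda>m. py (P m) / (A - c\<^sup>2)) (dx P) (dy P)"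
  proof
    show "A > 0" "A - c\<^sup>2 > 0" by fact+
    fix m
    have "A * (px (P m) / A)\<^sup>2 + (A - c\<^sup>2) * (py (P m) / (A - c\<^sup>2))\<^sup>2 = ((A - c\<^sup>2) * (px (P m))\<^sup>2 + A * (py (P m))\<^sup>2) / (A * (A - c\<^sup>2))"
      using A0 by (simp add: power2_eq_square add_divide_distrib)
    then show "A * (px (P m) / A)\<^sup>2 + (A - c\<^sup>2) * (py (P m) / (A - c\<^sup>2))\<^sup>2 = 1" unfolding E using A0 by simp
    show u: "(dx P m)\<^sup>2 + (dy P m)\<^sup>2 = 1" using unit_direction[of P m, OF ne] .
    obtain l where l: "l > 0" "px (P (m + 1)) = px (P m) + l * dx P m" "py (P (m + 1)) = py (P m) + l * dy P m"
      using next_vertex[of P m, OF ne] by blast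
    have "(dx P m * py (P m) - dy P m * px (P m))\<^sup>2 = k - (A - (A - c\<^sup>2)) * (dx P m)\<^sup>2"
      using mom[of m] unfolding mom_def by simp
    note chord = chord_normal_component[OF A0 E E l u this]
    show "dx P m * (px (P m) / A) + dy P m * (py (P m) / (A - c\<^sup>2)) = - sqrt ((A - k) / (A * (A - c\<^sup>2)))"
      by (rule chord(1))
    show "dx P m * (px (P (m + 1)) / A) + dy P m * (py (P (m + 1)) / (A - c\<^sup>2)) = sqrt ((A - k) / (A * (A - c\<^sup>2)))"
      by (rule chord(2))
    show "dx P m * ((A - c\<^sup>2) * (py (P m) / (A - c\<^sup>2))) - dy P m * (A * (px (P m) / A)) =
      dx P m * ((A - c\<^sup>2) * (py (P (m + 1)) / (A - c\<^sup>2))) - dy P m * (A * (px (P (m + 1)) / A))"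
    proof -
      have "A * (z / A) = z" "(A - c\<^sup>2) * (z / (A - c\<^sup>2)) = z" for z using A0 by simp_all
      then show ?thesis unfolding l(2,3) by (simp only:) (simp add: algebra_simps)
    qed
    have "reflection_law (conic A) (P m) (P (m + 1)) (P (m + 1 + 1))" using refl[of "m + 1"] by simp
    note r = reflection_law_ellipse(2)[OF A on this]
    have "sgn (P m - P (m + 1)) = - sgn (P (m + 1) - P m)" by (simp flip: sgn_minus)
    then show "dx P (m + 1) * (py (P (m + 1)) / (A - c\<^sup>2)) - dy P (m + 1) * (px (P (m + 1)) / A) =
      dx P m * (py (P (m + 1)) / (A - c\<^sup>2)) - dy P m * (px (P (m + 1)) / A)"
      using r unfolding dx_def dy_def by simp
  qed
qed

lemma moment_path:
  assumes "A > c\<^sup>2" "billiard_path A (A - c\<^sup>2) J (\<lambda>m. px (P m) / A) (\<lambda>m. py (P m) / (A - c\<^sup>2)) (dx P) (dy P)"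
  shows "billiard_path.moment A (A - c\<^sup>2) (\<lambda>m. px (P m) / A) (\<lambda>m. py (P m) / (A - c\<^sup>2)) (dx P) (dy P) m = mom P m"
proof -
  have "A \<noteq> 0" "A - c\<^sup>2 \<noteq> 0" using assms(1) zero_le_power2[of c] by linarith+
  then show ?thesis unfolding billiard_path.moment_def[OF assms(2)] mom_def by simp
qed

text \<open>The moment is minus the cross product of position and direction, so counterclockwise
  motion has negative moment.\<close>

lemma winding_moment:
  assumes "P m \<noteq> P (m + 1)"
  shows "det2 (P m - midpoint F1 F2) (P (m + 1) - midpoint F1 F2) > 0 \<longleftrightarrow> mom P m < 0"
    and "det2 (P m - midpoint F1 F2) (P (m + 1) - midpoint F1 F2) < 0 \<longleftrightarrow> mom P m > 0"
proof -
  obtain l where l: "l > 0" "px (P (m + 1)) = px (P m) + l * dx P m" "py (P (m + 1)) = py (P m) + l * dy P m"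
    using next_vertex[OF assms] by blast
  have "det2 (P m - midpoint F1 F2) (P (m + 1) - midpoint F1 F2) = - (l * mom P m)"
    unfolding det2_coord px_def[symmetric] py_def[symmetric] l mom_def by algebra
  then show "det2 (P m - midpoint F1 F2) (P (m + 1) - midpoint F1 F2) > 0 \<longleftrightarrow> mom P m < 0"
    "det2 (P m - midpoint F1 F2) (P (m + 1) - midpoint F1 F2) < 0 \<longleftrightarrow> mom P m > 0"
    using l(1) by (simp_all add: mult_less_0_iff zero_less_mult_iff)
qed

lemma crosses_long_axis_iff:
  assumes "c > 0"
  shows "crosses_long_axis F1 F2 X Y \<longleftrightarrow> py X < 0 \<and> 0 < py Y"
  unfolding crosses_long_axis_def det2_coord coord_focal coord_diff coord_foci using assms
  by (simp add: mult_less_0_iff zero_less_mult_iff)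

lemma same_crossing_iff:
  assumes "c > 0" and P: "\<And>m. py (P m) * py (P (m + 1)) < 0" and Q: "\<And>m. py (Q m) * py (Q (m + 1)) < 0"
  shows "same_crossing F1 F2 P Q m \<longleftrightarrow> py (P m) * py (Q m) > 0"
  using P[of m] Q[of m] unfolding same_crossing_def crosses_long_axis_iff[OF assms(1)]
  by (auto simp: mult_less_0_iff zero_less_mult_iff)

text \<open>Both factors change sign at every step, so the sign of the product is constant. Hence
  the crossing condition holds for every \<open>m\<close> or for none.\<close>

lemma alternating_signs:
  fixes f g :: "int \<Rightarrow> real"
  assumes f: "\<And>m. f m * f (m + 1) < 0" and g: "\<And>m. g m * g (m + 1) < 0"
  shows "f m * g m > 0 \<longleftrightarrow> f n * g n > 0"
proof -
  have step: "f (m + 1) * g (m + 1) > 0 \<longleftrightarrow> f m * g m > 0" for m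
    using f[of m] g[of m] by (auto simp: mult_less_0_iff zero_less_mult_iff)
  have "f m * g m > 0 \<longleftrightarrow> f 0 * g 0 > 0" for m
  proof (induction m rule: int_induct[where k = 0])
    case (step2 i)
    then show ?case using step[of "i - 1"] by simp
  qed (simp_all add: step)
  then show ?thesis by blast
qed

section \<open>The common conic of two trajectories\<close>

lemma trajectories_same_caustic:
  assumes A: "A > c\<^sup>2" and k: "k > 0" "k \<noteq> c\<^sup>2"
    and P: "billiard_trajectory (conic A) P" "\<And>m. tangent_line (conic k) (side_line P m)"
    and Q: "billiard_trajectory (conic A) Q" "\<And>m. tangent_line (conic k) (side_line Q m)"
  shows "\<exists>K. confocal_conic F1 F2 K \<and>
      (\<forall>m X. side_line P m \<inter> side_line Q m = {X} \<longrightarrow> X \<in> K) \<and>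
      (ellipse_with_foci F1 F2 (conic k) \<longrightarrow>
        (same_winding (midpoint F1 F2) P Q \<longrightarrow> ellipse_with_foci F1 F2 K) \<and>
        (opposite_winding (midpoint F1 F2) P Q \<longrightarrow>
          hyperbola_with_foci F1 F2 K \<or> long_axis F1 F2 K \<or> short_axis F1 F2 K)) \<and>
      (hyperbola_with_foci F1 F2 (conic k) \<longrightarrow>
        (\<forall>m. (same_crossing F1 F2 P Q m \<longrightarrow> hyperbola_with_foci F1 F2 K \<or> short_axis F1 F2 K) \<and>
             (\<not> same_crossing F1 F2 P Q m \<longrightarrow> ellipse_with_foci F1 F2 K \<or> long_axis F1 F2 K)))"
proof -
  have A0: "A > 0" "A - c\<^sup>2 > 0" using A zero_le_power2[of c] by linarith+
  have ne: "P m \<noteq> P (m + 1)" "Q m \<noteq> Q (m + 1)" for m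
    using P(1) Q(1) unfolding billiard_trajectory_def by auto
  note path = billiard_path_trajectory(1)[OF A k P] billiard_path_trajectory(1)[OF A k Q]
  note mom2 = billiard_path_trajectory(2)[OF A k P] billiard_path_trajectory(2)[OF A k Q]
  interpret pair: billiard_path_pair A "A - c\<^sup>2" "sqrt ((A - k) / (A * (A - c\<^sup>2)))"
    "\<lambda>m. px (P m) / A" "\<lambda>m. py (P m) / (A - c\<^sup>2)" "dx P" "dy P"
    "\<lambda>m. px (Q m) / A" "\<lambda>m. py (Q m) / (A - c\<^sup>2)" "dx Q" "dy Q"
    using path by (intro billiard_path_pair.intro)
  note mom = moment_path[OF A path(1)] moment_path[OF A path(2)]
  have num: "pair.conic_num m = c\<^sup>2 * (dx P m + dx Q m)\<^sup>2 + (mom P m + mom Q m)\<^sup>2" for m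
    unfolding pair.conic_num_def mom by simp
  have den: "pair.conic_den m = (dx P m + dx Q m)\<^sup>2 + (dy P m + dy Q m)\<^sup>2" for m
    unfolding pair.conic_den_def ..
  have winding: "mom P m * mom Q m > 0" if "same_winding (midpoint F1 F2) P Q" for m
    using that winding_moment[of P, OF ne(1)] winding_moment[of Q, OF ne(2)]
    unfolding same_winding_def winds_ccw_def winds_cw_def by (auto simp: zero_less_mult_iff)
  have winding': "mom P m * mom Q m < 0" if "opposite_winding (midpoint F1 F2) P Q" for m
    using that winding_moment[of P, OF ne(1)] winding_moment[of Q, OF ne(2)]
    unfolding opposite_winding_def winds_ccw_def winds_cw_def by (auto simp: mult_less_0_iff)
  \<comment> \<open>Each side crosses the long axis, so the sign of \<open>dy\<close> is opposite to
    that of the ordinate of its tail. This turns the crossing condition into a sign of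
    \<open>dy P n * dy Q n\<close>, as the inequality for \<open>\<kappa>\<close> requires.\<close>
  have crossing: "same_crossing F1 F2 P Q m \<longleftrightarrow> dy P n * dy Q n > 0" and dy0: "dy P n * dy Q n \<noteq> 0" and c0: "c > 0"
    if kc: "k < c\<^sup>2" for m n
  proof -
    show c: "c > 0" using kc k c by (cases "c = 0") auto
    have cross: "py (R m) * py (R (m + 1)) < 0 \<and> (\<exists>l > 0. py (R (m + 1)) = py (R m) + l * dy R m)"
      if R: "billiard_trajectory (conic A) R" "\<And>m. tangent_line (conic k) (side_line R m)" for R m
    proof -
      have ne: "R m \<noteq> R (m + 1)" and on: "R m \<in> conic A" "R (m + 1) \<in> conic A" 
        using R(1) unfolding billiard_trajectory_def by auto
      obtain l where l: "l > 0" "px (R (m + 1)) = px (R m) + l * dx R m" "py (R (m + 1)) = py (R m) + l * dy R m"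
        using next_vertex[OF ne] by blast
      have "py (R m) * py (R (m + 1)) < 0"
        using chord_crosses_axis[OF A0(2), of A "px (R m)" "py (R m)" "px (R (m + 1))" "py (R (m + 1))" l "dx R m" "dy R m" k]
          on l unit_direction[OF ne] billiard_path_trajectory(2)[OF A k R, of m] c kc unfolding conic_def mom_def by simp
      then show ?thesis using l by blast
    qed
    note cP = cross[OF P] and cQ = cross[OF Q]
    have "same_crossing F1 F2 P Q m \<longleftrightarrow> py (P m) * py (Q m) > 0"
      using cP cQ by (intro same_crossing_iff c) auto
    also have "\<dots> \<longleftrightarrow> py (P n) * py (Q n) > 0"
      using cP cQ by (intro alternating_signs) auto
    finally have 1: "same_crossing F1 F2 P Q m \<longleftrightarrow> py (P n) * py (Q n) > 0" .
    have sg: "(py (R n) < 0 \<and> dy R n > 0) \<or> (py (R n) > 0 \<and> dy R n < 0)" if R: "py (R n) * py (R (n + 1)) < 0 \<and> (\<exists>l > 0. py (R (n + 1)) = py (R n) + l * dy R n)" for R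
    proof -
      obtain l where l: "l > 0" "py (R (n + 1)) = py (R n) + l * dy R n" using R by blast
      have "(py (R n) < 0 \<and> l * dy R n > 0) \<or> (py (R n) > 0 \<and> l * dy R n < 0)"
        using R[THEN conjunct1] l(2) unfolding mult_less_0_iff[of "py (R n)"] by linarith
      then show ?thesis using l(1) by (simp add: zero_less_mult_iff mult_less_0_iff)
    qed
    show "dy P n * dy Q n \<noteq> 0" using sg[OF cP] sg[OF cQ] by auto
    show "same_crossing F1 F2 P Q m \<longleftrightarrow> dy P n * dy Q n > 0"
      unfolding 1 using sg[OF cP] sg[OF cQ] by (auto simp: zero_less_mult_iff)
  qed
  have kell: "ellipse_with_foci F1 F2 (conic k) \<longleftrightarrow> k > c\<^sup>2" and khyp: "hyperbola_with_foci F1 F2 (conic k) \<longleftrightarrow> k < c\<^sup>2"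
    using not_ellipse_and_hyperbola[of "conic k"] ellipse_iff[of "conic k"] hyperbola_iff[of "conic k"] k
    by (metis linorder_neqE_linordered_idom)+
  have conclude: ?thesis
    if "confocal_conic F1 F2 K" "\<And>m X. side_line P m \<inter> side_line Q m = {X} \<Longrightarrow> X \<in> K"
      "k > c\<^sup>2 \<Longrightarrow> same_winding (midpoint F1 F2) P Q \<Longrightarrow> ellipse_with_foci F1 F2 K"
      "k > c\<^sup>2 \<Longrightarrow> opposite_winding (midpoint F1 F2) P Q \<Longrightarrow>
        hyperbola_with_foci F1 F2 K \<or> long_axis F1 F2 K \<or> short_axis F1 F2 K"
      "\<And>m. k < c\<^sup>2 \<Longrightarrow> same_crossing F1 F2 P Q m \<Longrightarrow> hyperbola_with_foci F1 F2 K \<or> short_axis F1 F2 K"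
      "\<And>m. k < c\<^sup>2 \<Longrightarrow> \<not> same_crossing F1 F2 P Q m \<Longrightarrow> ellipse_with_foci F1 F2 K \<or> long_axis F1 F2 K" for K
    unfolding kell khyp by (rule exI[of _ K]) (intro conjI allI impI that; assumption)
  show ?thesis
  proof (cases "\<exists>m X. side_line P m \<inter> side_line Q m = {X}")
    case False
    \<comment> \<open>Without intersection points \<open>K\<close> only has to be of the required
      type.\<close>
    define K where "K = (if k > c\<^sup>2 then if same_winding (midpoint F1 F2) P Q then conic (c\<^sup>2 + 1) else {X. py X = 0}
       else if same_crossing F1 F2 P Q 0 then {X. px X = 0} else {X. py X = 0})"
    have disj: "\<not> (same_winding (midpoint F1 F2) P Q \<and> opposite_winding (midpoint F1 F2) P Q)"
      using winding[of 0] winding'[of 0] by (meson less_asym)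
    have same: "same_crossing F1 F2 P Q m \<longleftrightarrow> same_crossing F1 F2 P Q 0" if "k < c\<^sup>2" for m
      using crossing[OF that, of m 0] crossing[OF that, of 0 0] by simp
    have K: "k > c\<^sup>2 \<Longrightarrow> same_winding (midpoint F1 F2) P Q \<Longrightarrow> ellipse_with_foci F1 F2 K"
      "k > c\<^sup>2 \<Longrightarrow> \<not> same_winding (midpoint F1 F2) P Q \<Longrightarrow> long_axis F1 F2 K"
      "k < c\<^sup>2 \<Longrightarrow> same_crossing F1 F2 P Q 0 \<Longrightarrow> short_axis F1 F2 K"
      "k < c\<^sup>2 \<Longrightarrow> \<not> same_crossing F1 F2 P Q 0 \<Longrightarrow> long_axis F1 F2 K"
      using long_axis_line short_axis_line conic_ellipse[of "c\<^sup>2 + 1"] unfolding K_def by simp_all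
    show ?thesis
    proof (rule conclude[of K])
      show "confocal_conic F1 F2 K"
        using K k(2) unfolding confocal_conic_def by (meson linorder_neqE_linordered_idom)
    qed (use False K disj same in blast)+
  next
    case True
    then obtain m0 X0 where "side_line P m0 \<inter> side_line Q m0 = {X0}" by blast
    note det0 = single_intersection[of P m0 Q, OF ne this]
    \<comment> \<open>\<open>t\<close> is 1 plus the cosine of the angle between the two segments;
      since they meet in one point it is positive, and \<open>\<kappa> = S / t\<close>.\<close>
    define t where "t = 1 + (dx P m0 * dx Q m0 + dy P m0 * dy Q m0)"
    define S where "S = c\<^sup>2 * dx P m0 * dx Q m0 + mom P m0 * mom Q m0 + k"
    define \<kappa> where "\<kappa> = pair.conic_num m0 / pair.conic_den m0"
    have den0: "pair.conic_den m0 = 2 * t"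
      unfolding den t_def using unit_direction[of P m0, OF ne(1)] unit_direction[of Q m0, OF ne(2)] by algebra
    have num0: "pair.conic_num m0 = 2 * S"
      unfolding num S_def using mom2[of m0] by algebra
    have den_ne: "pair.conic_den m0 \<noteq> 0"
    proof
      assume "pair.conic_den m0 = 0"
      then have "dx P m0 + dx Q m0 = 0" "dy P m0 + dy Q m0 = 0" unfolding den by (simp_all add: sum_power2_eq_zero_iff)
      then have "dx Q m0 = - dx P m0" "dy Q m0 = - dy P m0" by linarith+
      then show False using det0 by simp
    qed
    have "pair.conic_den m0 \<ge> 0" "pair.conic_num m0 \<ge> 0" unfolding den num by simp_all
    then have t: "t > 0" and kap0: "\<kappa> \<ge> 0" using den_ne den0 unfolding \<kappa>_def by auto
    have kt: "\<kappa> * t = S" unfolding \<kappa>_def den0 num0 using t by simp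
    have kap: "pair.conic_num m = \<kappa> * pair.conic_den m" for m
      using pair.conic_invariant[OF den_ne, of m] den_ne unfolding \<kappa>_def by (simp add: field_simps)
    have inK: "X \<in> conic \<kappa>" if X: "side_line P m \<inter> side_line Q m = {X}" for m X
    proof -
      have "X \<in> side_line P m" "X \<in> side_line Q m" using X by auto
      from intersection_on_conic[OF unit_direction[of P m, OF ne(1)] unit_direction[of Q m, OF ne(2)] on_side_line[OF this(1)] on_side_line[OF this(2)]
         mom2 kap[of m, unfolded num den] single_intersection[of P m Q, OF ne X]]
      show ?thesis unfolding conic_def by simp
    qed
    have kap_iff: "\<kappa> > c\<^sup>2 \<longleftrightarrow> c\<^sup>2 * dy P m0 * dy Q m0 - (k - c\<^sup>2) < mom P m0 * mom Q m0"
      "\<kappa> < c\<^sup>2 \<longleftrightarrow> mom P m0 * mom Q m0 < c\<^sup>2 * dy P m0 * dy Q m0 - (k - c\<^sup>2)"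
    proof -
      have "S - c\<^sup>2 * t = mom P m0 * mom Q m0 - (c\<^sup>2 * dy P m0 * dy Q m0 - (k - c\<^sup>2))"
        unfolding S_def t_def by algebra
      then have *: "(\<kappa> - c\<^sup>2) * t = mom P m0 * mom Q m0 - (c\<^sup>2 * dy P m0 * dy Q m0 - (k - c\<^sup>2))"
        unfolding left_diff_distrib kt .
      have "\<kappa> > c\<^sup>2 \<longleftrightarrow> (\<kappa> - c\<^sup>2) * t > 0" "\<kappa> < c\<^sup>2 \<longleftrightarrow> (\<kappa> - c\<^sup>2) * t < 0"
        using t by (simp_all add: zero_less_mult_iff mult_less_0_iff)
      then show "\<kappa> > c\<^sup>2 \<longleftrightarrow> c\<^sup>2 * dy P m0 * dy Q m0 - (k - c\<^sup>2) < mom P m0 * mom Q m0"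
      "\<kappa> < c\<^sup>2 \<longleftrightarrow> mom P m0 * mom Q m0 < c\<^sup>2 * dy P m0 * dy Q m0 - (k - c\<^sup>2)"
        unfolding * by auto
    qed
    have p2: "(mom P m0)\<^sup>2 = (k - c\<^sup>2) + c\<^sup>2 * (dy P m0)\<^sup>2" "(mom Q m0)\<^sup>2 = (k - c\<^sup>2) + c\<^sup>2 * (dy Q m0)\<^sup>2"
      using mom2[of m0] unit_direction[of P m0, OF ne(1)] unit_direction[of Q m0, OF ne(2)] by algebra+
    have e1: "\<kappa> > c\<^sup>2" if "k > c\<^sup>2" "same_winding (midpoint F1 F2) P Q"
      using elliptic_caustic_sign(1)[OF p2] winding[OF that(2)] that kap_iff by simp
    have e2: "\<kappa> \<le> c\<^sup>2" if "k > c\<^sup>2" "opposite_winding (midpoint F1 F2) P Q"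
      using elliptic_caustic_sign(2)[OF p2] winding'[OF that(2), of m0] that kap_iff by simp
    have p2': "(mom P m0)\<^sup>2 = c\<^sup>2 * (dy P m0)\<^sup>2 - (c\<^sup>2 - k)" "(mom Q m0)\<^sup>2 = c\<^sup>2 * (dy Q m0)\<^sup>2 - (c\<^sup>2 - k)"
      using p2 by auto
    have h1: "\<kappa> < c\<^sup>2" if "k < c\<^sup>2" "same_crossing F1 F2 P Q m" for m
      using hyperbolic_caustic_sign(1)[OF p2'] crossing[OF that(1), of m m0] that kap_iff c0[OF that(1)] by simp
    have h2: "\<kappa> \<ge> c\<^sup>2" if "k < c\<^sup>2" "\<not> same_crossing F1 F2 P Q m" for m
    proof -
      have "dy P m0 * dy Q m0 < 0" using crossing[OF that(1), of m m0] dy0[OF that(1), of m0] that(2) by linarith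
      then have "c\<^sup>2 * dy P m0 * dy Q m0 + (c\<^sup>2 - k) \<le> mom P m0 * mom Q m0"
        using hyperbolic_caustic_sign(2)[OF p2'] that(1) c0[OF that(1)] by simp
      then show ?thesis using kap_iff(2) by linarith
    qed
    show ?thesis
    proof (cases "\<kappa> = c\<^sup>2 \<and> c = 0")
      \<comment> \<open>Here \<open>conic \<kappa>\<close> is the whole plane, so \<open>K\<close>
        must be found otherwise. All total moments vanish, so the sum of the two line equations is a
        line through the centre. By \<open>parallel_invariant\<close> it is the same diameter for
        all \<open>m\<close>.\<close>
      case circle: True
      then have k_pos: "k > c\<^sup>2" using k by simp
      define a b where "a = dx P m0 + dx Q m0" and "b = dy P m0 + dy Q m0"
      have ab: "a \<noteq> 0 \<or> b \<noteq> 0" using den_ne unfolding den a_def b_def by auto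
      have m0: "mom P m + mom Q m = 0" for m
        using kap[of m] circle unfolding num by simp
      have par: "a * (dy P m + dy Q m) = (dx P m + dx Q m) * b" for m
        using pair.parallel_invariant[OF _ den_ne, of m] unfolding mom m0 a_def b_def by simp
      define K where "K = {X. - b * px X + a * py X = 0}"
      have "X \<in> K" if X: "side_line P m \<inter> side_line Q m = {X}" for m X
      proof -
        have "X \<in> side_line P m" "X \<in> side_line Q m" using X by auto
        then have "(dx P m + dx Q m) * py X - (dy P m + dy Q m) * px X = 0"
          using on_side_line[of X P m] on_side_line[of X Q m] m0[of m] by (simp add: algebra_simps)
        moreover have "dx P m + dx Q m \<noteq> 0 \<or> dy P m + dy Q m \<noteq> 0"
        proof (rule ccontr)
          assume "\<not> ?thesis"
          then have "dx Q m = - dx P m" "dy Q m = - dy P m" by auto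
          then show False using single_intersection[of P m Q, OF ne X] by simp
        qed
        moreover have "(dx P m + dx Q m) * (- b * px X + a * py X) = 0" "(dy P m + dy Q m) * (- b * px X + a * py X) = 0"
          using calculation(1) par[of m] by algebra+
        ultimately show ?thesis unfolding K_def by auto
      qed
      moreover have "long_axis F1 F2 K" unfolding K_def using circle ab by (intro long_axis_circle) auto
      moreover have "\<not> same_winding (midpoint F1 F2) P Q" "\<not> k < c\<^sup>2" using e1 circle k_pos by auto
      ultimately show ?thesis by (intro conclude[of K]) (auto simp: confocal_conic_def)
    next
      case False
      have gt: "ellipse_with_foci F1 F2 (conic \<kappa>)" if "\<kappa> > c\<^sup>2" using that by (rule conic_ellipse)
      have lt: "hyperbola_with_foci F1 F2 (conic \<kappa>) \<or> short_axis F1 F2 (conic \<kappa>)" if "\<kappa> < c\<^sup>2"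
        using conic_hyperbola[OF kap0 that] .
      have eq: "long_axis F1 F2 (conic \<kappa>)" if "\<kappa> = c\<^sup>2"
        using conic_long_axis that False c by auto
      show ?thesis
      proof (rule conclude[of "conic \<kappa>"])
        show "confocal_conic F1 F2 (conic \<kappa>)"
          using gt lt eq unfolding confocal_conic_def by (meson linorder_neqE_linordered_idom)
        show "hyperbola_with_foci F1 F2 (conic \<kappa>) \<or> long_axis F1 F2 (conic \<kappa>) \<or> short_axis F1 F2 (conic \<kappa>)"
          if "k > c\<^sup>2" "opposite_winding (midpoint F1 F2) P Q"
          using e2[OF that] lt eq by (metis order_le_less)
        show "ellipse_with_foci F1 F2 (conic \<kappa>) \<or> long_axis F1 F2 (conic \<kappa>)"
          if "k < c\<^sup>2" "\<not> same_crossing F1 F2 P Q m" for m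
          using h2[OF that] gt eq by (metis order_le_less)
      qed (use inK gt lt e1 h1 in blast)+
    qed
  qed
qed

end

lemma focal_frame_exists: "\<exists>u c. focal_frame F1 F2 u c"
proof (cases "F1 = F2")
  case True
  then have "focal_frame F1 F2 (axis 1 1) 0" by unfold_locales (simp_all add: axis_def)
  then show ?thesis by blast
next
  case False
  define u where "u = sgn (F2 - F1)"
  have "norm u = 1" unfolding u_def using False by (simp add: norm_sgn)
  then have "u \<bullet> u = 1" by (simp add: dot_square_norm)
  then have "(u $ 1)\<^sup>2 + (u $ 2)\<^sup>2 = 1" by (simp add: inner_vec_def sum_2 power2_eq_square)
  moreover have "F2 - F1 = (2 * (norm (F2 - F1) / 2)) *\<^sub>R u" unfolding u_def sgn_div_norm using False by simp
  ultimately have "focal_frame F1 F2 u (norm (F2 - F1) / 2)" by unfold_locales simp_all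
  then show ?thesis by blast
qed

theorem theorem17:
  fixes F1 F2 :: "real^2" and E C :: "(real^2) set" and P Q :: "int \<Rightarrow> real^2"
  assumes "ellipse_with_foci F1 F2 E"
    and "billiard_trajectory E P" and "billiard_trajectory E Q"
    and "caustic F1 F2 P C" and "caustic F1 F2 Q C"
  shows "\<exists>K. confocal_conic F1 F2 K \<and>
      (\<forall>m X. side_line P m \<inter> side_line Q m = {X} \<longrightarrow> X \<in> K) \<and>
      (ellipse_with_foci F1 F2 C \<longrightarrow>
        (same_winding (midpoint F1 F2) P Q \<longrightarrow> ellipse_with_foci F1 F2 K) \<and>
        (opposite_winding (midpoint F1 F2) P Q \<longrightarrow>
          hyperbola_with_foci F1 F2 K \<or> long_axis F1 F2 K \<or> short_axis F1 F2 K)) \<and>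
      (hyperbola_with_foci F1 F2 C \<longrightarrow>
        (\<forall>m. (same_crossing F1 F2 P Q m \<longrightarrow> hyperbola_with_foci F1 F2 K \<or> short_axis F1 F2 K) \<and>
             (\<not> same_crossing F1 F2 P Q m \<longrightarrow> ellipse_with_foci F1 F2 K \<or> long_axis F1 F2 K)))"
proof -
  obtain u c where "focal_frame F1 F2 u c" using focal_frame_exists by blast
  then interpret focal_frame F1 F2 u c .
  obtain A where A: "A > c\<^sup>2" "E = conic A" using assms(1) ellipse_iff by blast
  have "ellipse_with_foci F1 F2 C \<or> hyperbola_with_foci F1 F2 C" using assms(4) unfolding caustic_def by blast
  then have "\<exists>k>0. k \<noteq> c\<^sup>2 \<and> C = conic k"
    using ellipse_iff[of C] hyperbola_iff[of C] zero_le_power2[of c] by (metis less_irrefl order_le_less_trans)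
  then obtain k where k: "k > 0" "k \<noteq> c\<^sup>2" "C = conic k" by blast
  show ?thesis
    using trajectories_same_caustic[OF A(1) k(1,2)] assms unfolding A(2) k(3) caustic_def by blast
qed

end
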